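(* The minimal co-factor set of $T_6 \cap P_{1,8}$ is $$\Lambda(6,1,8) = \{x^3 + x^2 + x + 1,\ x^3 + 2x^2 + 2x + 1\}.$$
   Context: A Salem number is a real algebraic integer $\beta>1$ whose other Galois conjugates all satisfy $|\alpha|\le 1$, with at least one satisfying $|\alpha|=1$. For real $\beta>1$, the greedy beta expansion $d_\beta(1)=(c_n)_{n\ge1}$ is defined by $r_0=1$, and for $n\ge 1$: $c_n=\lfloor \beta r_{n-1}\rfloor$, $r_n=\beta r_{n-1}-\lfloor \beta r_{n-1}\rfloor$. If it is eventually periodic, $\beta$ is called a Parry number, and the smallest $m\ge0$ and $p\ge1$ with $c_{n+m}=c_{n+m+p}$ for all $n\ge1$ are the preperiod length and the period length of the expansion. (By convention $p=0$ if $r_N=0$ for some $N$; this never happens for Salem numbers.) For a Salem number $\beta$ that is a Parry number with preperiod length $m$ and period length $p\geq 1$, put $P_k(x)=x^k-c_1x^{k-1}-\dots-c_k$. The companion polynomial is $R(x)=P_{m+p}(x)-P_m(x)$; it has $\beta$ as a root, so $R(x)=P(x)Q(x)$ with $P$ the minimal polynomial of $\beta$ and $Q\in\mathbb{Z}[x]$; $Q$ is the co-factor of $\beta$. $T_n$ denotes the set of all Salem numbers of degree $n$. $P_{m,p}$ denotes the set of Salem Parry numbers whose beta expansion $d_\beta(1)$ has preperiod length $m$ and period length $p$. $C_{Q(x)}$ denotes the set of all Salem (Parry) numbers whose co-factor is $Q(x)$. The minimal co-factor set $\Lambda(n,m,p)\subseteq\mathbb{Z}[x]$ of $T_n\cap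 P_{m,p}$ is the minimal set (with respect to inclusion) $\Lambda$ satisfying $T_n\cap P_{m,p}=P_{m,p}\cap\bigl(\bigcup_{q(x)\in\Lambda}C_{q(x)}\bigr)$ when the members are understood as co-factors of elements of $T_n\cap P_{m,p}$; i.e. it is the set of all co-factors of elements of $T_n\cap P_{m,p}$. *)

theory Defs
  imports Complex_Main "HOL-Computational_Algebra.Computational_Algebra"
begin

section \<open>Salem numbers\<close>

definition min_poly :: "real \<Rightarrow> rat poly" where
  "min_poly x = (THE p. lead_coeff p = 1 \<and> irreducible p \<and> poly (map_poly of_rat p) x = 0)"

definition other_conjugates :: "real \<Rightarrow> complex set" where
  "other_conjugates x = {z. poly (map_poly of_rat (min_poly x)) z = 0} - {of_real x}"

definition salem :: "real \<Rightarrow> bool" where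
  "salem \<beta> \<longleftrightarrow> algebraic_int \<beta> \<and> \<beta> > 1 \<and>
     (\<forall>z\<in>other_conjugates \<beta>. norm z \<le> 1) \<and> (\<exists>z\<in>other_conjugates \<beta>. norm z = 1)"

definition salem_deg :: "nat \<Rightarrow> real set" where
  "salem_deg n = {\<beta>. salem \<beta> \<and> degree (min_poly \<beta>) = n}"


section \<open>The greedy expansion of 1 in base \<open>\<beta>\<close>\<close>

fun beta_rem :: "real \<Rightarrow> nat \<Rightarrow> real" where
  "beta_rem \<beta> 0 = 1"
| "beta_rem \<beta> (Suc n) = \<beta> * beta_rem \<beta> n - of_int \<lfloor>\<beta> * beta_rem \<beta> n\<rfloor>"

text \<open>Digits are indexed from 1; \<open>beta_digit \<beta> 0\<close> has no meaning and is never used.\<close>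

definition beta_digit :: "real \<Rightarrow> nat \<Rightarrow> int" where
  "beta_digit \<beta> n = \<lfloor>\<beta> * beta_rem \<beta> (n - 1)\<rfloor>"

definition periodic_from :: "real \<Rightarrow> nat \<Rightarrow> nat \<Rightarrow> bool" where
  "periodic_from \<beta> m p \<longleftrightarrow> p \<ge> 1 \<and> (\<forall>n\<ge>1. beta_digit \<beta> (n + m) = beta_digit \<beta> (n + m + p))"

definition parry :: "real \<Rightarrow> bool" where
  "parry \<beta> \<longleftrightarrow> (\<exists>m p. periodic_from \<beta> m p)"

definition preperiod_length :: "real \<Rightarrow> nat" where
  "preperiod_length \<beta> = (LEAST m. \<exists>p. periodic_from \<beta> m p)"

text \<open>A finite expansion has period length 0 by convention; this does not occur for Salem numbers.\<close>

definition period_length :: "real \<Rightarrow> nat" where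
  "period_length \<beta> = (if \<exists>N. beta_rem \<beta> N = 0 then 0
     else (LEAST p. periodic_from \<beta> (preperiod_length \<beta>) p))"

definition salem_parry :: "nat \<Rightarrow> nat \<Rightarrow> real set" where
  "salem_parry m p = {\<beta>. salem \<beta> \<and> parry \<beta> \<and> preperiod_length \<beta> = m \<and> period_length \<beta> = p}"


section \<open>Companion polynomial and co-factor\<close>

definition digit_poly :: "real \<Rightarrow> nat \<Rightarrow> int poly" where
  "digit_poly \<beta> k = monom 1 k - (\<Sum>i=1..k. monom (beta_digit \<beta> i) (k - i))"

definition companion_poly :: "real \<Rightarrow> int poly" where
  "companion_poly \<beta> = digit_poly \<beta> (preperiod_length \<beta> + period_length \<beta>)
                      - digit_poly \<beta> (preperiod_length \<beta>)"

text \<open>\<open>with_cofactor Q\<close> is the set of Salem Parry numbers whose co-factor is \<open>Q\<close>. The factorization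
  \<open>R = P Q\<close> is stated over the rationals because \<^const>\<open>min_poly\<close> lives there; \<open>Q\<close> is integral.\<close>

definition with_cofactor :: "int poly \<Rightarrow> real set" where
  "with_cofactor Q = {\<beta>. salem \<beta> \<and> parry \<beta> \<and> period_length \<beta> \<ge> 1 \<and>
     map_poly of_int (companion_poly \<beta>) = min_poly \<beta> * map_poly of_int Q}"

definition cofactors_of :: "real set \<Rightarrow> int poly set" where
  "cofactors_of S = {Q. \<exists>\<beta>\<in>S. \<beta> \<in> with_cofactor Q}"

definition is_cofactor_set :: "nat \<Rightarrow> nat \<Rightarrow> nat \<Rightarrow> int poly set \<Rightarrow> bool" where
  "is_cofactor_set n m p L \<longleftrightarrow> L \<subseteq> cofactors_of (salem_deg n \<inter> salem_parry m p) \<and>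
     salem_deg n \<inter> salem_parry m p = salem_parry m p \<inter> (\<Union>q\<in>L. with_cofactor q)"

text \<open>The least such set with respect to inclusion.\<close>

definition minimal_cofactor_set :: "nat \<Rightarrow> nat \<Rightarrow> nat \<Rightarrow> int poly set" where
  "minimal_cofactor_set n m p = (LEAST L. is_cofactor_set n m p L)"


text \<open>Co-factors are unique, so the only candidate is the set of all co-factors of members.\<close>

lemma coeff_digit_poly_ge:
  assumes "j \<ge> k"
  shows "coeff (digit_poly \<beta> k) j = (if j = k then 1 else 0)"
proof -
  have "(\<Sum>i=1..k. coeff (monom (beta_digit \<beta> i) (k - i)) j) = 0"
    using assms by (intro sum.neutral) auto
  then show ?thesis
    by (simp add: digit_poly_def coeff_sum)
qed

lemma companion_poly_nonzero:
  assumes "period_length \<beta> \<ge> 1"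
  shows "companion_poly \<beta> \<noteq> 0"
proof -
  have "coeff (companion_poly \<beta>) (preperiod_length \<beta> + period_length \<beta>) = 1"
    using assms by (simp add: companion_poly_def coeff_digit_poly_ge)
  then show ?thesis by auto
qed

lemma with_cofactor_unique:
  assumes "\<beta> \<in> with_cofactor Q" "\<beta> \<in> with_cofactor Q'"
  shows "Q = Q'"
proof -
  have "companion_poly \<beta> \<noteq> 0"
    using assms companion_poly_nonzero by (auto simp: with_cofactor_def)
  then obtain i where "coeff (companion_poly \<beta>) i \<noteq> 0"
    by (auto simp: poly_eq_iff)
  then have "coeff (map_poly (of_int :: int \<Rightarrow> rat) (companion_poly \<beta>)) i \<noteq> 0"
    by (simp add: coeff_map_poly)
  then have "map_poly (of_int :: int \<Rightarrow> rat) (companion_poly \<beta>) \<noteq> 0"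
    by auto
  then have "min_poly \<beta> \<noteq> 0"
    using assms by (auto simp: with_cofactor_def)
  then have "map_poly (of_int :: int \<Rightarrow> rat) Q = map_poly of_int Q'"
    using assms by (auto simp: with_cofactor_def)
  then have "coeff (map_poly (of_int :: int \<Rightarrow> rat) Q) i = coeff (map_poly of_int Q') i" for i
    by simp
  then show ?thesis
    by (simp add: coeff_map_poly poly_eq_iff)
qed

lemma is_cofactor_set_unique:
  assumes "is_cofactor_set n m p L"
  shows "L = cofactors_of (salem_deg n \<inter> salem_parry m p)"
  using assms with_cofactor_unique
  unfolding is_cofactor_set_def cofactors_of_def by blast

lemma minimal_cofactor_set_eq:
  assumes "is_cofactor_set n m p L"
  shows "minimal_cofactor_set n m p = cofactors_of (salem_deg n \<inter> salem_parry m p)"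
proof -
  have "(LEAST L. is_cofactor_set n m p L) = L"
    using assms is_cofactor_set_unique by (intro Least_equality) blast+
  then show ?thesis
    unfolding minimal_cofactor_set_def using is_cofactor_set_unique[OF assms] by simp
qed

end

theory Submission
  imports Defs
begin

text \<open>Let \<open>P = x\<^sup>6 + a x\<^sup>5 + b x\<^sup>4 + c x\<^sup>3 + b x\<^sup>2 + a x + 1\<close> be the minimal polynomial, which is reciprocal
  since it has a root on the unit circle, and let \<open>Q = x\<^sup>3 + q\<^sub>2 x\<^sup>2 + q\<^sub>1 x + q\<^sub>0\<close> be the co-factor. Comparing
  coefficients in \<open>P Q = R\<close> expresses all digits through these six integers. Three constraints then leave
  only \<open>Q = x\<^sup>3 + k x\<^sup>2 + k x + 1\<close> with \<open>k \<in> {1, 2}\<close>: the digits lie between \<open>0\<close> and \<open>c\<^sub>1\<close>, no shift of the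
  digit sequence exceeds the sequence itself lexicographically, and \<open>Q(1) > 0\<close>, since the root \<open>\<beta>\<close> of
  the companion polynomial \<open>R\<close> is simple and is its only root in \<open>[1, \<infinity>)\<close>.
  Both values occur, for \<open>x\<^sup>6 - 2x\<^sup>5 + x\<^sup>3 - 2x + 1\<close> with digits \<open>1, 1, 0, 1, 1, 0, 1, 0, 0\<close> and for
  \<open>x\<^sup>6 - 4x\<^sup>5 + 6x\<^sup>4 - 7x\<^sup>3 + 6x\<^sup>2 - 4x + 1\<close> with digits \<open>2, 0, 2, 0, 0, 2, 0, 1, 1\<close>.\<close>

section \<open>Polynomials over the integers and the rationals\<close>

abbreviation rat_poly_of :: "int poly \<Rightarrow> rat poly" where
  "rat_poly_of \<equiv> map_poly of_int"

abbreviation eval_rat :: "rat poly \<Rightarrow> 'a::field_char_0 \<Rightarrow> 'a" where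
  "eval_rat p x \<equiv> poly (map_poly of_rat p) x"

lemma map_poly_add_hom:
  assumes "f 0 = 0" "\<And>x y. f (x + y) = f x + f y"
  shows "map_poly f (p + q) = map_poly f p + map_poly f q"
  by (rule poly_eqI) (simp add: coeff_map_poly assms)

lemma map_poly_mult_hom:
  fixes f :: "'a::comm_ring_1 \<Rightarrow> 'b::comm_ring_1"
  assumes "f 0 = 0" "\<And>x y. f (x + y) = f x + f y" "\<And>x y. f (x * y) = f x * f y"
  shows "map_poly f (p * q) = map_poly f p * map_poly f q"
proof (rule poly_eqI)
  fix n
  have sum: "f (sum g A) = (\<Sum>a\<in>A. f (g a))" if "finite A" for g :: "nat \<Rightarrow> 'a" and A
    using that by induction (simp_all add: assms)
  show "coeff (map_poly f (p * q)) n = coeff (map_poly f p * map_poly f q) n"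
    by (simp add: coeff_map_poly coeff_mult sum assms)
qed

lemma map_poly_of_int_mult:
  "map_poly (of_int :: int \<Rightarrow> 'a::comm_ring_1) (p * q) = map_poly of_int p * map_poly of_int q"
  by (rule map_poly_mult_hom) simp_all

lemma map_poly_of_int_inject:
  "map_poly (of_int :: int \<Rightarrow> 'a::ring_char_0) p = map_poly of_int q \<longleftrightarrow> p = q"
  by (auto simp: poly_eq_iff coeff_map_poly)

lemma eval_rat_mult [simp]: "eval_rat (p * q) x = eval_rat p x * eval_rat q x"
  by (subst map_poly_mult_hom) (simp_all add: of_rat_add of_rat_mult)

lemma eval_rat_add [simp]: "eval_rat (p + q) x = eval_rat p x + eval_rat q x"
  by (subst map_poly_add_hom) (simp_all add: of_rat_add)

lemma eval_rat_of_int: "eval_rat (rat_poly_of p) x = poly (map_poly of_int p) x"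
  by (subst map_poly_map_poly) (simp_all add: o_def)

lemma degree_rat_poly_of [simp]: "degree (rat_poly_of p) = degree p"
  by (rule degree_map_poly) simp

text \<open>Among the nonzero rational polynomials vanishing at \<open>x\<close>, one of least
  degree is scaled to be monic. Division with remainder makes it divide all others, and a
  factorization into two non-constant factors would produce an annihilator of smaller
  degree.\<close>

lemma minimal_rat_poly_exists:
  fixes x :: "'a::field_char_0"
  assumes "p \<noteq> 0" "eval_rat p x = 0"
  obtains m where "lead_coeff m = 1" "irreducible m" "eval_rat m x = 0"
    "\<And>q. eval_rat q x = 0 \<Longrightarrow> m dvd q"
proof -
  define S where "S d \<longleftrightarrow> (\<exists>p. p \<noteq> 0 \<and> eval_rat p x = 0 \<and> degree p = d)" for d
  define d where "d = (LEAST d. S d)"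
  have "S d"
    unfolding d_def using assms by (intro LeastI[of S "degree p"]) (auto simp: S_def)
  then obtain r where r: "r \<noteq> 0" "eval_rat r x = 0" "degree r = d"
    unfolding S_def by blast
  have least: "d \<le> degree q" if "q \<noteq> 0" "eval_rat q x = 0" for q
    unfolding d_def using that by (intro Least_le) (auto simp: S_def)
  define m where "m = smult (inverse (lead_coeff r)) r"
  have "coeff r d \<noteq> 0" using r leading_coeff_0_iff by blast
  then have lead: "lead_coeff m = 1" and deg: "degree m = d" and "m \<noteq> 0"
    using r by (simp_all add: m_def)
  have "m = [:inverse (lead_coeff r):] * r"
    by (simp add: m_def)
  then have root: "eval_rat m x = 0"
    using r(2) by (simp only: eval_rat_mult) simp
  have dvd: "m dvd q" if "eval_rat q x = 0" for q
  proof -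
    have "eval_rat (q div m * m + q mod m) x = 0"
      using that by simp
    then have "eval_rat (q mod m) x = 0"
      using root by (simp only: eval_rat_add eval_rat_mult) simp
    then have "q mod m = 0"
      using least[of "q mod m"] degree_mod_less[of m q] \<open>m \<noteq> 0\<close> deg by linarith
    then show ?thesis by auto
  qed
  have "irreducible m"
  proof (rule irreducibleI)
    show "m \<noteq> 0" by fact
    show "\<not> m dvd 1"
    proof
      assume "m dvd 1"
      then obtain k where "1 = m * k" by (elim dvdE)
      then have "eval_rat 1 x = eval_rat m x * eval_rat k x"
        by (metis eval_rat_mult)
      then show False using root by simp
    qed
    fix a b assume ab: "m = a * b"
    then have nz: "a \<noteq> 0" "b \<noteq> 0" using \<open>m \<noteq> 0\<close> by auto
    have degs: "degree a + degree b = d"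
      using ab deg nz by (simp add: degree_mult_eq)
    have "eval_rat a x = 0 \<or> eval_rat b x = 0"
      using root ab by simp
    then have "degree b = 0 \<or> degree a = 0"
      using least nz degs by force
    then show "a dvd 1 \<or> b dvd 1"
      using nz by (auto simp: is_unit_iff_degree)
  qed
  then show thesis using that lead root dvd by blast
qed

lemma irreducible_dvd_monic_eq:
  fixes m p :: "'a::field poly"
  assumes "m dvd p" "irreducible p" "\<not> m dvd 1" "lead_coeff m = 1" "lead_coeff p = 1"
  shows "p = m"
proof -
  obtain k where k: "p = m * k" using assms(1) by (elim dvdE)
  then have "k dvd 1" using assms(2,3) irreducibleD by blast
  then obtain c where c: "k = [:c:]" by (auto simp: is_unit_poly_iff)
  have "lead_coeff p = lead_coeff m * lead_coeff k"
    unfolding k by (rule lead_coeff_mult)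
  then have "c = 1" using assms(4,5) c by simp
  then show ?thesis using k c by simp
qed

lemma irreducible_rat_dvd:
  fixes x :: "'a::field_char_0"
  assumes "irreducible p" "lead_coeff p = 1" "eval_rat p x = 0" "eval_rat q x = 0"
  shows "p dvd q"
proof -
  have "p \<noteq> 0" using assms by auto
  then obtain m where m: "lead_coeff m = 1" "irreducible m" "\<And>q. eval_rat q x = 0 \<Longrightarrow> m dvd q"
    using minimal_rat_poly_exists assms(3) by metis
  then have "p = m"
    using assms by (intro irreducible_dvd_monic_eq) (auto dest: irreducible_not_unit)
  then show ?thesis using m assms by blast
qed

text \<open>Uniqueness of the monic irreducible annihilator turns the description in
  \<open>min_poly\<close> into a usable equation.\<close>

lemma min_poly_eqI:
  assumes "lead_coeff p = 1" "irreducible p" "eval_rat p x = 0"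
  shows "min_poly x = p"
  unfolding min_poly_def
proof (rule the_equality)
  fix q assume q: "lead_coeff q = 1 \<and> irreducible q \<and> eval_rat q x = 0"
  then have "p dvd q" using irreducible_rat_dvd[of p x q] assms by blast
  with q show "q = p"
    using assms by (intro irreducible_dvd_monic_eq) (auto dest: irreducible_not_unit)
qed (use assms in simp)

lemma algebraic_int_rootE:
  fixes x :: "'a::field_char_0"
  assumes "algebraic_int x"
  obtains p where "lead_coeff p = 1" "poly (map_poly of_int p) x = 0"
proof -
  obtain p where p: "\<forall>i. coeff p i \<in> \<int>" "lead_coeff p = 1" "poly p x = 0"
    using assms by (auto elim!: algebraic_int.cases)
  \<comment> \<open>On integral elements this description inverts \<open>of_int\<close>, so
    \<open>q\<close> is \<open>p\<close> pulled back to integer coefficients.\<close>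
  define q where "q = map_poly (\<lambda>c. THE k. of_int k = c) p"
  have the: "(THE k. of_int k = (of_int n :: 'a)) = n" for n
    by (rule the_equality) auto
  have "map_poly of_int q = p"
  proof (rule poly_eqI)
    fix i
    have "(THE k. of_int k = (0::'a)) = 0" using the[of 0] by simp
    then show "coeff (map_poly of_int q) i = coeff p i"
      using p(1) unfolding q_def by (auto simp: coeff_map_poly elim!: Ints_cases dest!: spec[of _ i] simp: the)
  qed
  moreover from this have "degree p = degree q"
    by (metis degree_map_poly of_int_0 of_int_eq_iff)
  ultimately show thesis
    using p that[of q] by (metis coeff_map_poly of_int_0 of_int_1 of_int_eq_iff)
qed

lemma algebraic_int_rootI:
  fixes x :: "'a::field_char_0"
  assumes "lead_coeff p = 1" "poly (map_poly of_int p) x = 0"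
  shows "algebraic_int x"
proof (rule algebraic_int.intros)
  show "lead_coeff (map_poly of_int p :: 'a poly) = 1"
    using assms(1) by (simp add: coeff_map_poly degree_map_poly)
qed (use assms in \<open>auto simp: coeff_map_poly\<close>)

lemma min_poly_algebraic_int:
  assumes "algebraic_int x"
  shows "lead_coeff (min_poly x) = 1" "irreducible (min_poly x)" "eval_rat (min_poly x) x = 0"
    "\<And>q. eval_rat q x = 0 \<Longrightarrow> min_poly x dvd q"
proof -
  obtain p where p: "lead_coeff p = 1" "poly (map_poly of_int p) x = 0"
    using assms by (rule algebraic_int_rootE)
  have "rat_poly_of p \<noteq> 0" "eval_rat (rat_poly_of p) x = 0"
    using p by (auto simp: eval_rat_of_int map_poly_eq_0_iff)
  then obtain m where m: "lead_coeff m = 1" "irreducible m" "eval_rat m x = 0"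
    using minimal_rat_poly_exists by blast
  then have "min_poly x = m" by (rule min_poly_eqI)
  with m show "lead_coeff (min_poly x) = 1" "irreducible (min_poly x)" "eval_rat (min_poly x) x = 0"
    "\<And>q. eval_rat q x = 0 \<Longrightarrow> min_poly x dvd q"
    using irreducible_rat_dvd[of m x] by blast+
qed

section \<open>Gauss's lemma for monic factors\<close>

lemma clear_denominators:
  fixes p :: "rat poly"
  obtains d :: int and p' where "d > 0" "rat_poly_of p' = smult (of_int d) p"
proof -
  have "\<exists>d::int. d > 0 \<and> (\<exists>p'. rat_poly_of p' = smult (of_int d) p)"
  proof (induction p)
    case 0
    show ?case by (intro exI[of _ 1]) (auto intro: exI[of _ 0])
  next
    case (pCons a p)
    then obtain d p' where d: "d > 0" "rat_poly_of p' = smult (of_int d) p" by blast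
    obtain u v where uv: "a = of_int u / of_int v" "v > 0"
      by (cases a rule: Rat_cases) (auto simp: Fract_of_int_quotient)
    have "rat_poly_of (pCons (u * d) (smult v p')) = smult (of_int (v * d)) (pCons a p)"
      using uv d by (simp add: map_poly_pCons map_poly_smult)
    then show ?case using d uv by (intro exI[of _ "v * d"]) auto
  qed
  then show thesis using that by blast
qed

text \<open>Scaling \<open>f\<close> and \<open>g\<close> by \<open>d\<close> and \<open>e\<close>
  gives integral \<open>f'\<close> and \<open>g'\<close>. As \<open>r\<close> is primitive,
  \<open>content f' * content g' = d * e\<close>; as \<open>f\<close> and \<open>g\<close> are
  monic, these contents divide \<open>d\<close> and \<open>e\<close>. Equality holds in both, so
  \<open>d\<close> can be cancelled from \<open>f'\<close>.\<close>

lemma monic_factor_integral: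
  fixes f g :: "rat poly" and r :: "int poly"
  assumes "rat_poly_of r = f * g" "lead_coeff f = 1" "lead_coeff g = 1"
  obtains f' where "f = rat_poly_of f'"
proof -
  obtain d f' where d: "d > 0" "rat_poly_of f' = smult (of_int d) f" by (rule clear_denominators)
  obtain e g' where e: "e > 0" "rat_poly_of g' = smult (of_int e) g" by (rule clear_denominators)
  have "coeff (rat_poly_of r) (degree (rat_poly_of r)) = 1"
    unfolding assms(1) using assms(2,3) by (simp add: lead_coeff_mult)
  then have "coeff r (degree r) = 1"
    by (simp add: coeff_map_poly)
  then have "content r dvd 1"
    using content_dvd_coeff[of r "degree r"] by simp
  then have cr: "content r = 1"
    using is_unit_normalize normalize_content by metis
  have "rat_poly_of (f' * g') = rat_poly_of (smult (d * e) r)"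
    by (simp add: map_poly_of_int_mult d e map_poly_smult assms(1) mult.commute)
  then have "f' * g' = smult (d * e) r"
    by (simp only: map_poly_of_int_inject)
  then have cc: "content f' * content g' = d * e"
    using d e cr by (metis abs_of_pos content_mult content_smult mult.right_neutral mult_pos_pos normalize_int_def)
  \<comment> \<open>The number \<open>k\<close> is itself a coefficient of \<open>p'\<close>, at the
    degree of the monic \<open>p\<close>.\<close>
  have lead: "content p' dvd k" if "rat_poly_of p' = smult (of_int k) p" "lead_coeff p = 1" for p' p k
  proof -
    have "coeff (rat_poly_of p') (degree p) = of_int k" using that by simp
    then have "coeff p' (degree p) = k" by (simp add: coeff_map_poly)
    then show ?thesis using content_dvd_coeff by blast
  qed
  have cf: "content f' dvd d" and cg: "content g' dvd e"
    using lead d e assms by blast+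
  obtain k where k: "d = content f' * k" using cf by (elim dvdE)
  have "content g' = k * e"
  proof -
    have "content f' \<noteq> 0" using k d by auto
    then show ?thesis using cc k by simp
  qed
  then have "k * e dvd e" using cg by simp
  then have "k dvd 1" using e by (metis dvd_mult_cancel_right less_irrefl mult_1)
  then have "d dvd content f'" using k by auto
  then have "[:d:] dvd f'"
    by (simp add: const_poly_dvd_iff_dvd_content)
  then obtain h where "f' = smult d h" by (auto elim!: dvdE)
  then have "smult (of_int d) (rat_poly_of h) = smult (of_int d) f"
    using d(2) by (simp add: map_poly_smult)
  then have "f = rat_poly_of h" using d(1) by (simp add: smult_eq_iff)
  then show thesis using that by blast
qed

lemma min_poly_integral_cofactor:
  assumes "lead_coeff r = 1" "poly (map_poly of_int r) \<beta> = 0"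
  obtains f g where "r = f * g" "min_poly \<beta> = rat_poly_of f" "lead_coeff f = 1" "lead_coeff g = 1"
proof -
  have "algebraic_int \<beta>" using assms by (rule algebraic_int_rootI)
  note m = min_poly_algebraic_int[OF this]
  have "min_poly \<beta> dvd rat_poly_of r"
    using m(4) assms(2) by (simp add: eval_rat_of_int)
  then obtain k where k: "rat_poly_of r = min_poly \<beta> * k" by (elim dvdE)
  have "lead_coeff (rat_poly_of r) = 1" using assms(1) by (simp add: coeff_map_poly)
  then have lk: "lead_coeff k = 1"
    unfolding k lead_coeff_mult using m(1) by simp
  obtain f where f: "min_poly \<beta> = rat_poly_of f"
    using monic_factor_integral[OF k m(1) lk] by blast
  obtain g where g: "k = rat_poly_of g"
    using monic_factor_integral[OF k[unfolded mult.commute[of "min_poly \<beta>"]] lk m(1)] by blast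
  show thesis
  proof
    show "r = f * g"
      using k unfolding f g by (metis map_poly_of_int_mult map_poly_of_int_inject)
    show "lead_coeff f = 1" "lead_coeff g = 1"
      using m(1) lk unfolding f g by (simp_all add: coeff_map_poly)
  qed (rule f)
qed

section \<open>Greedy expansions\<close>

lemma beta_rem_Suc: "beta_rem \<beta> (Suc n) = \<beta> * beta_rem \<beta> n - of_int (beta_digit \<beta> (Suc n))"
  by (simp add: beta_digit_def)

lemma beta_rem_bounds: "0 \<le> beta_rem \<beta> n" "beta_rem \<beta> n \<le> 1"
  using floor_correct[of "\<beta> * beta_rem \<beta> (n - 1)"] by (cases n; simp; linarith)+

lemma beta_digit_mono:
  assumes "\<beta> > 0" "beta_rem \<beta> a \<le> beta_rem \<beta> b"
  shows "beta_digit \<beta> (Suc a) \<le> beta_digit \<beta> (Suc b)"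
  using assms by (auto simp: beta_digit_def intro!: floor_mono mult_left_mono)

lemma beta_rem_mono:
  assumes "\<beta> > 0" "beta_rem \<beta> a \<le> beta_rem \<beta> b" "beta_digit \<beta> (Suc a) = beta_digit \<beta> (Suc b)"
  shows "beta_rem \<beta> (Suc a) \<le> beta_rem \<beta> (Suc b)"
  using assms by (simp add: beta_rem_Suc del: beta_rem.simps)

lemma beta_digit_bounds:
  assumes "\<beta> > 0"
  shows "0 \<le> beta_digit \<beta> n" "beta_digit \<beta> n \<le> beta_digit \<beta> 1"
proof -
  show "0 \<le> beta_digit \<beta> n"
    using assms beta_rem_bounds by (simp add: beta_digit_def)
  show "beta_digit \<beta> n \<le> beta_digit \<beta> 1"
    using beta_digit_mono[OF assms, of "n - 1" 0] beta_rem_bounds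
    by (simp add: beta_digit_def)
qed

lemma beta_digit_1_pos: "\<beta> > 1 \<Longrightarrow> beta_digit \<beta> 1 \<ge> 1"
  by (simp add: beta_digit_def le_floor_iff)

text \<open>Equal digits cancel in the recursion, so the difference of the two remainders is
  multiplied by \<open>\<beta>\<close> in each step. A nonzero difference would outgrow the bound
  1.\<close>

lemma beta_rem_eqI:
  assumes "\<beta> > 1" "\<And>n. beta_digit \<beta> (a + Suc n) = beta_digit \<beta> (b + Suc n)"
  shows "beta_rem \<beta> a = beta_rem \<beta> b"
proof (rule ccontr)
  assume ne: "beta_rem \<beta> a \<noteq> beta_rem \<beta> b"
  define d where "d = \<bar>beta_rem \<beta> a - beta_rem \<beta> b\<bar>"
  have *: "\<bar>beta_rem \<beta> (a + n) - beta_rem \<beta> (b + n)\<bar> = \<beta> ^ n * d" for n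
  proof (induction n)
    case (Suc n)
    have "beta_rem \<beta> (a + Suc n) - beta_rem \<beta> (b + Suc n) = \<beta> * (beta_rem \<beta> (a + n) - beta_rem \<beta> (b + n))"
      using assms(2)[of n] by (simp add: beta_rem_Suc algebra_simps del: beta_rem.simps)
    then show ?case using Suc assms(1) by (simp add: abs_mult)
  qed (simp add: d_def)
  have "d > 0" using ne by (simp add: d_def)
  then obtain n where "\<beta> ^ n > 1 / d" using real_arch_pow assms(1) by blast
  then have "\<beta> ^ n * d > 1" using \<open>d > 0\<close> by (simp add: field_simps)
  moreover have "\<bar>beta_rem \<beta> (a + n) - beta_rem \<beta> (b + n)\<bar> \<le> 1"
    using beta_rem_bounds[of \<beta> "a + n"] beta_rem_bounds[of \<beta> "b + n"] by linarith
  ultimately show False using * by simp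
qed

lemma beta_digit_shift:
  assumes "beta_rem \<beta> a = beta_rem \<beta> b"
  shows "beta_digit \<beta> (a + Suc n) = beta_digit \<beta> (b + Suc n)"
proof -
  have "beta_rem \<beta> (a + n) = beta_rem \<beta> (b + n)"
    using assms by (induction n) simp_all
  then show ?thesis by (simp add: beta_digit_def)
qed

text \<open>A remainder determines all later digits and is determined by them, so a condition on
  infinitely many digits reduces to one equation.\<close>

lemma periodic_from_iff_rem:
  assumes "\<beta> > 1"
  shows "periodic_from \<beta> m p \<longleftrightarrow> p \<ge> 1 \<and> beta_rem \<beta> m = beta_rem \<beta> (m + p)"
proof -
  have "(\<forall>n\<ge>1. Q n) \<longleftrightarrow> (\<forall>n. Q (Suc n))" for Q
    by (auto simp: Suc_le_eq gr0_conv_Suc)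
  then have "(\<forall>n\<ge>1. beta_digit \<beta> (n + m) = beta_digit \<beta> (n + m + p)) \<longleftrightarrow>
      (\<forall>n. beta_digit \<beta> (m + Suc n) = beta_digit \<beta> (m + p + Suc n))"
    by (simp add: ac_simps)
  also have "\<dots> \<longleftrightarrow> beta_rem \<beta> m = beta_rem \<beta> (m + p)"
    using beta_rem_eqI[OF assms] beta_digit_shift by blast
  finally show ?thesis by (simp add: periodic_from_def)
qed

section \<open>Digit polynomials and Horner's scheme\<close>

lemma coeff_digit_poly_less:
  assumes "j < k"
  shows "coeff (digit_poly \<beta> k) j = - beta_digit \<beta> (k - j)"
proof -
  have "(\<Sum>i=1..k. coeff (monom (beta_digit \<beta> i) (k - i)) j) =
      (\<Sum>i\<in>{k - j}. beta_digit \<beta> i)"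
    using assms by (intro sum.mono_neutral_cong_right) auto
  then show ?thesis using assms by (simp add: digit_poly_def coeff_sum)
qed

lemma digit_poly_0: "digit_poly \<beta> 0 = 1"
  by (simp add: digit_poly_def)

lemma digit_poly_Suc: "digit_poly \<beta> (Suc k) = pCons (- beta_digit \<beta> (Suc k)) (digit_poly \<beta> k)"
proof (rule poly_eqI)
  fix j
  show "coeff (digit_poly \<beta> (Suc k)) j = coeff (pCons (- beta_digit \<beta> (Suc k)) (digit_poly \<beta> k)) j"
  proof (cases j)
    case 0
    then show ?thesis by (simp add: coeff_digit_poly_less)
  next
    case (Suc i)
    then show ?thesis
      by (cases "i < k") (simp_all add: coeff_digit_poly_less coeff_digit_poly_ge)
  qed
qed

lemma digit_poly_1: "digit_poly \<beta> 1 = [:- beta_digit \<beta> 1, 1:]"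
  by (simp add: digit_poly_0 digit_poly_Suc one_pCons)

lemma digit_poly_9:
  "digit_poly \<beta> 9 = [:- beta_digit \<beta> 9, - beta_digit \<beta> 8, - beta_digit \<beta> 7, - beta_digit \<beta> 6,
     - beta_digit \<beta> 5, - beta_digit \<beta> 4, - beta_digit \<beta> 3, - beta_digit \<beta> 2, - beta_digit \<beta> 1, 1:]"
  by (simp add: digit_poly_0 digit_poly_Suc one_pCons numeral_eq_Suc)

text \<open>Horner's recursion for the digit polynomials, evaluated at \<open>\<beta>\<close>, is
  the recursion of the remainders.\<close>

lemma poly_digit_poly: "poly (map_poly of_int (digit_poly \<beta> k)) \<beta> = beta_rem \<beta> k"
  by (induction k) (simp_all add: digit_poly_0 digit_poly_Suc map_poly_pCons beta_rem_Suc del: beta_rem.simps(2))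

lemma companion_poly_1_8:
  assumes "preperiod_length \<beta> = 1" "period_length \<beta> = 8"
  shows "companion_poly \<beta> = [:beta_digit \<beta> 1 - beta_digit \<beta> 9, - beta_digit \<beta> 8 - 1,
     - beta_digit \<beta> 7, - beta_digit \<beta> 6, - beta_digit \<beta> 5, - beta_digit \<beta> 4, - beta_digit \<beta> 3,
     - beta_digit \<beta> 2, - beta_digit \<beta> 1, 1:]"
proof -
  have "companion_poly \<beta> = digit_poly \<beta> 9 - digit_poly \<beta> 1"
    using assms by (simp add: companion_poly_def)
  then show ?thesis unfolding digit_poly_9 digit_poly_1 by simp
qed

lemma periodic_1_8D:
  assumes "\<beta> > 1" "parry \<beta>" "preperiod_length \<beta> = 1" "period_length \<beta> = 8"
  shows "beta_rem \<beta> 9 = beta_rem \<beta> 1" "beta_digit \<beta> 9 \<noteq> beta_digit \<beta> 1" "beta_rem \<beta> n > 0"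
proof -
  have "\<forall>N. beta_rem \<beta> N \<noteq> 0" and eq: "(LEAST p. periodic_from \<beta> 1 p) = 8"
    using assms(3,4) by (auto simp: period_length_def split: if_splits)
  show "beta_rem \<beta> n > 0"
    using \<open>\<forall>N. beta_rem \<beta> N \<noteq> 0\<close> beta_rem_bounds(1)[of \<beta> n] by (simp add: less_le)
  have "\<exists>m p. periodic_from \<beta> m p" using assms(2) by (simp add: parry_def)
  then have "\<exists>p. periodic_from \<beta> 1 p"
    using assms(3) LeastI_ex[of "\<lambda>m. \<exists>p. periodic_from \<beta> m p"] by (simp add: preperiod_length_def)
  then have "periodic_from \<beta> 1 8" using eq LeastI_ex by metis
  then show r: "beta_rem \<beta> 9 = beta_rem \<beta> 1" using assms(1) by (simp add: periodic_from_iff_rem)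
  show "beta_digit \<beta> 9 \<noteq> beta_digit \<beta> 1"
  proof
    \<comment> \<open>Since \<open>\<beta> r_8 = c9 + r_9\<close> and
      \<open>\<beta> r_0 = c1 + r_1\<close>, this would give \<open>r_8 = r_0\<close> and a purely
      periodic expansion.\<close>
    assume "beta_digit \<beta> 9 = beta_digit \<beta> 1"
    then have "\<beta> * beta_rem \<beta> 8 = \<beta> * beta_rem \<beta> 0"
      using r beta_rem_Suc[of \<beta> 8] beta_rem_Suc[of \<beta> 0] by simp
    then have "periodic_from \<beta> 0 8" using assms(1) by (simp add: periodic_from_iff_rem)
    then have "preperiod_length \<beta> = 0" by (auto simp: preperiod_length_def intro!: Least_eq_0)
    then show False using assms(3) by simp
  qed
qed

text \<open>Only the first nine digits and remainders enter the hypotheses, so they can be verified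
  for an explicit \<open>\<beta>\<close>. The inequalities exclude a shorter preperiod, a shorter
  period and a finite expansion.\<close>

lemma periodic_1_8I:
  assumes "\<beta> > 1" "beta_rem \<beta> 9 = beta_rem \<beta> 1" "beta_digit \<beta> 9 \<noteq> beta_digit \<beta> 1"
    "\<And>p. 1 \<le> p \<Longrightarrow> p < 8 \<Longrightarrow> beta_rem \<beta> (1 + p) \<noteq> beta_rem \<beta> 1"
    "beta_rem \<beta> 1 \<noteq> 0"
  shows "parry \<beta>" "preperiod_length \<beta> = 1" "period_length \<beta> = 8"
proof -
  have p8: "periodic_from \<beta> 1 8"
    using assms by (simp add: periodic_from_iff_rem)
  then show "parry \<beta>" by (auto simp: parry_def)
  have shift: "beta_rem \<beta> (1 + 8 * k) = beta_rem \<beta> 1" for k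
  proof (induction k)
    case (Suc k)
    have "beta_rem \<beta> (1 + 8 * k + j) = beta_rem \<beta> (1 + j)" for j
      using Suc by (induction j) simp_all
    from this[of 8] show ?case using assms(2) by (simp add: add.commute)
  qed simp
  have "\<not> periodic_from \<beta> 0 p" for p
  proof
    assume "periodic_from \<beta> 0 p"
    then have p: "p \<ge> 1" "beta_rem \<beta> p = beta_rem \<beta> 0"
      using assms by (simp_all add: periodic_from_iff_rem)
    have *: "beta_rem \<beta> (p * k) = beta_rem \<beta> 0" for k
    proof (induction k)
      case (Suc k)
      have "beta_rem \<beta> (p * k + j) = beta_rem \<beta> (0 + j)" for j
        using Suc by (induction j) simp_all
      from this[of p] show ?case using p(2) by (simp add: add.commute)
    qed simp
    \<comment> \<open>The digit at index \<open>8 p + 1\<close> is read in two ways: a pure period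
      \<open>p\<close> makes it \<open>c1\<close>, and with \<open>q = p - 1\<close> the period 8
      makes it \<open>c9\<close>.\<close>
    obtain q where q: "p * 8 + 1 = 1 + 8 * q + Suc 7"
      using that[of "p - 1"] p(1) by simp
    have "beta_digit \<beta> (p * 8 + 1) = beta_digit \<beta> 1"
      using *[of 8] by (simp add: beta_digit_def)
    moreover have "beta_digit \<beta> (p * 8 + 1) = beta_digit \<beta> (1 + Suc 7)"
      unfolding q using shift by (intro beta_digit_shift) simp
    ultimately show False using assms(3) by simp
  qed
  then have "1 \<le> m" if "\<exists>p. periodic_from \<beta> m p" for m
    using that by (cases m) auto
  then show pre: "preperiod_length \<beta> = 1"
    unfolding preperiod_length_def using p8 by (intro Least_equality exI[of _ 8])
  have "(LEAST p. periodic_from \<beta> 1 p) = 8"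
  proof (rule Least_equality)
    show "periodic_from \<beta> 1 8" by fact
    fix p assume "periodic_from \<beta> 1 p"
    then have "p \<ge> 1" "beta_rem \<beta> (1 + p) = beta_rem \<beta> 1"
      using assms(1) by (simp_all add: periodic_from_iff_rem)
    then show "8 \<le> p" using assms(4) by (meson not_le)
  qed
  moreover have "beta_rem \<beta> N \<noteq> 0" for N
  proof
    assume "beta_rem \<beta> N = 0"
    then have "beta_rem \<beta> (N + j) = 0" for j by (induction j) simp_all
    \<comment> \<open>The index becomes \<open>1 + 8 N\<close>, where the remainder equals
      \<open>r_1\<close>.\<close>
    from this[of "1 + 7 * N"] show False using shift[of N] assms(5) by (simp add: algebra_simps del: beta_rem.simps)
  qed
  ultimately show "period_length \<beta> = 8"
    using pre by (simp add: period_length_def)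
qed

text \<open>The remainders \<open>r\<^sub>n\<close> are the coefficients of the synthetic division by \<open>x - \<beta>\<close>.\<close>

lemma companion_poly_factor:
  assumes "preperiod_length \<beta> = 1" "period_length \<beta> = 8" "beta_rem \<beta> 9 = beta_rem \<beta> 1"
  shows "map_poly of_int (companion_poly \<beta>) = [:- \<beta>, 1:] *
    [:beta_rem \<beta> 8 - 1, beta_rem \<beta> 7, beta_rem \<beta> 6, beta_rem \<beta> 5, beta_rem \<beta> 4, beta_rem \<beta> 3,
      beta_rem \<beta> 2, beta_rem \<beta> 1, 1:]"
proof -
  have d: "of_int (beta_digit \<beta> n) = \<beta> * beta_rem \<beta> (n - 1) - beta_rem \<beta> n" if "n > 0" for n
    using that beta_rem_Suc[of \<beta> "n - 1"] by simp
  have 0: "beta_rem \<beta> 0 = 1" by simp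
  show ?thesis
    unfolding companion_poly_1_8[OF assms(1,2)]
    using d[of 1] d[of 2] d[of 3] d[of 4] d[of 5] d[of 6] d[of 7] d[of 8] d[of 9] assms(3) 0
    by (simp add: map_poly_pCons algebra_simps del: beta_rem.simps)
qed

section \<open>The factorization of the companion polynomial\<close>

lemma map_poly_of_rat_reflect:
  "map_poly (of_rat :: rat \<Rightarrow> 'a::field_char_0) (reflect_poly p) = reflect_poly (map_poly of_rat p)"
  by (rule poly_eqI) (simp add: coeff_map_poly coeff_reflect_poly degree_map_poly)

text \<open>A conjugate \<open>z\<close> on the unit circle satisfies \<open>1/z = cnj z\<close>, so it is also a root of the reflected polynomial.\<close>

lemma salem_min_poly_reciprocal:
  assumes "salem \<beta>" "degree (min_poly \<beta>) > 1"
  shows "reflect_poly (min_poly \<beta>) = min_poly \<beta>"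
proof -
  define m where "m = min_poly \<beta>"
  have m: "lead_coeff m = 1" "irreducible m"
    using assms(1) min_poly_algebraic_int(1,2) by (auto simp: salem_def m_def)
  have "m \<noteq> 0" using m by auto
  obtain z :: complex where z: "eval_rat m z = 0" "norm z = 1"
    using assms(1) by (auto simp: salem_def other_conjugates_def m_def)
  have "z * cnj z = 1" using z(2) by (simp add: complex_norm_square[symmetric])
  moreover from this have "z \<noteq> 0" by auto
  ultimately have inv: "inverse z = cnj z" by (metis inverse_unique)
  have "cnj (of_rat q) = of_rat q" for q
    by (cases q rule: Rat_cases) (simp add: of_rat_rat)
  then have "map_poly cnj (map_poly of_rat m) = map_poly of_rat m"
    by (intro poly_eqI) (simp add: coeff_map_poly)
  then have "eval_rat m (cnj z) = 0"
    using z(1) poly_cnj[of "map_poly of_rat m" z] by simp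
  then have "eval_rat (reflect_poly m) z = 0"
    using \<open>z \<noteq> 0\<close> by (simp add: map_poly_of_rat_reflect poly_reflect_poly_nz inv)
  then have "m dvd reflect_poly m"
    using irreducible_rat_dvd m z(1) by blast
  then obtain k where k: "reflect_poly m = m * k" by (elim dvdE)
  have "k \<noteq> 0" using k \<open>m \<noteq> 0\<close> by auto
  then have "degree m + degree k \<le> degree m"
    using k degree_reflect_poly_le[of m] \<open>m \<noteq> 0\<close> by (simp add: degree_mult_eq)
  then obtain c where "k = [:c:]" by (auto elim: degree_eq_zeroE)
  then have refl: "reflect_poly m = smult c m" using k by simp
  \<comment> \<open>Comparing coefficients in \<open>refl\<close> gives \<open>1 = c * m(0)\<close>
    at degree 0 and \<open>m(0) = c\<close> at the top degree.\<close>
  have "coeff (reflect_poly m) 0 = 1" "coeff (reflect_poly m) (degree m) = coeff m 0"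
    using m by (simp, simp add: coeff_reflect_poly)
  then have "c * c = 1" using refl m by simp
  then consider "c = 1" | "c = -1" by (metis square_eq_1_iff)
  then show ?thesis
  proof cases
    case 1
    then show ?thesis using refl by (simp add: m_def)
  next
    case 2
    \<comment> \<open>An antireciprocal polynomial vanishes at 1, so \<open>m\<close> would divide
      \<open>x - 1\<close>.\<close>
    have "eval_rat (reflect_poly m) (1::real) = eval_rat m 1"
      by (simp add: map_poly_of_rat_reflect poly_reflect_poly_nz)
    moreover have "map_poly of_rat (smult c m) = smult (of_rat c) (map_poly of_rat m :: real poly)"
      by (simp add: map_poly_smult of_rat_mult)
    ultimately have "eval_rat m (1::real) = 0" using refl 2 by simp
    moreover have "eval_rat [:-1, 1:] (1::real) = 0" by (simp add: map_poly_pCons)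
    ultimately have "m dvd [:-1, 1:]" using irreducible_rat_dvd m by blast
    then have "degree m \<le> 1" using dvd_imp_degree_le[of m "[:-1, 1:]"] by simp
    then show ?thesis using assms(2) by (simp add: m_def)
  qed
qed

text \<open>A monic polynomial is positive for large arguments, so a negative value at
  \<open>a\<close> would force a root beyond \<open>a\<close>.\<close>

lemma monic_poly_pos:
  fixes p :: "real poly"
  assumes "lead_coeff p = 1" "\<And>x. x \<ge> a \<Longrightarrow> poly p x \<noteq> 0"
  shows "poly p a > 0"
proof (rule ccontr)
  assume "\<not> poly p a > 0"
  then have neg: "poly p a < 0" using assms(2)[of a] by (simp add: not_less less_le)
  obtain n where "\<And>x. x \<ge> n \<Longrightarrow> poly p x \<ge> 1"
    using poly_pinfty_gt_lc[of p] assms(1) by auto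
  then have "poly p (max n (a + 1)) > 0" by (meson max.cobounded1 order_less_le_trans zero_less_one)
  then show False
    using poly_IVT_pos[of a "max n (a + 1)" p] neg assms(2) by force
qed

text \<open>All remainders are positive, so \<open>\<beta>\<close> is the only root of the companion polynomial in
  \<open>[1, \<infinity>)\<close> and it is simple; hence the co-factor has no root there.\<close>

lemma cofactor_pos_at_1:
  assumes "\<beta> > 1" "parry \<beta>" "preperiod_length \<beta> = 1" "period_length \<beta> = 8"
    "companion_poly \<beta> = P * Q" "poly (map_poly of_int P) \<beta> = 0" "lead_coeff Q = 1"
  shows "poly Q 1 > 0"
proof -
  define G where "G = [:beta_rem \<beta> 8 - 1, beta_rem \<beta> 7, beta_rem \<beta> 6, beta_rem \<beta> 5, beta_rem \<beta> 4,
    beta_rem \<beta> 3, beta_rem \<beta> 2, beta_rem \<beta> 1, 1:]"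
  obtain S where S: "map_poly of_int P = [:- \<beta>, 1:] * S"
    using assms(6) by (auto simp: poly_eq_0_iff_dvd elim: dvdE)
  \<comment> \<open>Both factorizations of the companion polynomial contain
    \<open>x - \<beta>\<close>; cancelling it exhibits \<open>Q\<close> as a divisor of
    \<open>G\<close>.\<close>
  have "[:- \<beta>, 1:] * G = [:- \<beta>, 1:] * (S * map_poly of_int Q)"
    using companion_poly_factor[of \<beta>] periodic_1_8D(1) assms
    by (simp only: G_def map_poly_of_int_mult S mult.assoc)
  then have GS: "G = S * map_poly of_int Q"
    by (metis mult_left_cancel pCons_eq_0_iff zero_neq_one)
  have "poly (map_poly of_int Q) x \<noteq> (0::real)" if "x \<ge> 1" for x
  proof -
    note r = periodic_1_8D(3)[OF assms(1-4)]
    have t: "0 \<le> beta_rem \<beta> k * x ^ n" for k n using r[of k] that by simp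
    \<comment> \<open>The \<open>-1\<close> from the constant coefficient is absorbed by
      \<open>x ^ 8 \<ge> 1\<close>, and \<open>r_8 > 0\<close> makes the inequality strict.\<close>
    have "poly G x = x ^ 8 - 1 + beta_rem \<beta> 1 * x ^ 7 + beta_rem \<beta> 2 * x ^ 6 + beta_rem \<beta> 3 * x ^ 5
        + beta_rem \<beta> 4 * x ^ 4 + beta_rem \<beta> 5 * x ^ 3 + beta_rem \<beta> 6 * x ^ 2 + beta_rem \<beta> 7 * x + beta_rem \<beta> 8"
      by (simp add: G_def algebra_simps power_numeral_reduce)
    also have "\<dots> > 0"
      using t[of 1 7] t[of 2 6] t[of 3 5] t[of 4 4] t[of 5 3] t[of 6 2] t[of 7 1] r[of 8]
        one_le_power[OF that, of 8] by (simp del: beta_rem.simps)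
    finally show ?thesis using GS by auto
  qed
  moreover have "lead_coeff (map_poly of_int Q :: real poly) = 1"
    using assms(7) by (simp add: coeff_map_poly degree_map_poly)
  ultimately have "poly (map_poly of_int Q) (1::real) > 0" by (rule monic_poly_pos[rotated])
  moreover have "poly (map_poly of_int Q) (1::real) = of_int (poly Q 1)"
    by (induction Q) (simp_all add: map_poly_pCons)
  ultimately show ?thesis by simp
qed

text \<open>A coefficient list of known length lets later proofs name the individual
  coefficients.\<close>

lemma monic_poly_coeffs:
  fixes p :: "'a::comm_semiring_1 poly"
  assumes "lead_coeff p = 1" "degree p = n"
  obtains cs where "length cs = n" "p = Poly (cs @ [1])"
proof
  have "p \<noteq> 0" using assms by auto
  then have "coeffs p \<noteq> []" "length (coeffs p) = Suc n" "last (coeffs p) = 1"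
    using assms by (simp_all add: length_coeffs_degree last_coeffs_eq_coeff_degree)
  then show "length (butlast (coeffs p)) = n" "p = Poly (butlast (coeffs p) @ [1])"
    by (simp, metis Poly_coeffs append_butlast_last_id)
qed

text \<open>The companion polynomial has degree 9 and the minimal polynomial degree 6, so the
  co-factor is an integral monic cubic \<open>Q\<close>. Reciprocity leaves \<open>a\<close>,
  \<open>b\<close>, \<open>c\<close> free, and the last inequality is
  \<open>Q(1) > 0\<close>.\<close>

lemma salem_parry_1_8_factorization:
  assumes "\<beta> \<in> salem_deg 6" "\<beta> \<in> salem_parry 1 8"
  obtains a b c q0 q1 q2 where
    "companion_poly \<beta> = [:1, a, b, c, b, a, 1:] * [:q0, q1, q2, 1:]"
    "\<beta> \<in> with_cofactor [:q0, q1, q2, 1:]"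
    "1 + q2 + q1 + q0 > 0"
proof -
  have salem: "salem \<beta>" and deg: "degree (min_poly \<beta>) = 6" and parry: "parry \<beta>"
    and pre: "preperiod_length \<beta> = 1" and per: "period_length \<beta> = 8"
    using assms by (auto simp: salem_deg_def salem_parry_def)
  then have b1: "\<beta> > 1" and alg: "algebraic_int \<beta>" by (auto simp: salem_def)
  note m = min_poly_algebraic_int[OF alg]
  note C = companion_poly_1_8[OF pre per]
  have degC: "degree (companion_poly \<beta>) = 9" and leadC: "lead_coeff (companion_poly \<beta>) = 1"
    unfolding C by simp_all
  have "poly (map_poly of_int (companion_poly \<beta>)) \<beta> = 0"
    using companion_poly_factor[OF pre per] periodic_1_8D(1)[OF b1 parry pre per] by simp
  then obtain P Q where CPQ: "companion_poly \<beta> = P * Q" and P: "min_poly \<beta> = rat_poly_of P"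
    and leadP: "lead_coeff P = 1" and leadQ: "lead_coeff Q = 1"
    using min_poly_integral_cofactor[OF leadC] by blast
  have degP: "degree P = 6" using deg P by simp
  have "P \<noteq> 0" "Q \<noteq> 0" using leadP leadQ by auto
  then have "degree P + degree Q = 9"
    using degC CPQ by (simp add: degree_mult_eq)
  then have degQ: "degree Q = 3" using degP by simp
  obtain q0 q1 q2 where Q': "Q = [:q0, q1, q2, 1:]"
    by (rule monic_poly_coeffs[OF leadQ degQ]) (auto simp: length_Suc_conv numeral_eq_Suc)
  have "coeff (reflect_poly (rat_poly_of P)) n = coeff (rat_poly_of P) n" for n
    using salem_min_poly_reciprocal[OF salem] deg P by simp
  then have "coeff P n = coeff P (6 - n)" if "n \<le> 6" for n
    using that degP by (metis coeff_map_poly coeff_reflect_poly degree_rat_poly_of not_le of_int_0 of_int_eq_iff)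
  from this[of 0] this[of 1] this[of 2]
  have sym: "coeff P 0 = coeff P 6" "coeff P 1 = coeff P 5" "coeff P 2 = coeff P 4"
    by simp_all
  obtain p0 p1 p2 p3 p4 p5 where P': "P = [:p0, p1, p2, p3, p4, p5, 1:]"
    by (rule monic_poly_coeffs[OF leadP degP]) (auto simp: length_Suc_conv numeral_eq_Suc)
  then have P'': "P = [:1, p1, p2, p3, p2, p1, 1:]"
    using sym unfolding P' by (simp add: coeff_pCons numeral_eq_Suc)
  have "poly (map_poly of_int P) \<beta> = 0"
    using m(3) unfolding P by (simp add: eval_rat_of_int)
  then have "poly Q 1 > 0"
    by (intro cofactor_pos_at_1[OF b1 parry pre per CPQ] leadQ)
  then have "1 + q2 + q1 + q0 > 0"
    unfolding Q' by simp
  moreover have "rat_poly_of (companion_poly \<beta>) = min_poly \<beta> * rat_poly_of Q"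
    by (simp only: CPQ P map_poly_of_int_mult)
  then have "\<beta> \<in> with_cofactor [:q0, q1, q2, 1:]"
    using salem parry per Q' by (simp add: with_cofactor_def)
  ultimately show thesis
    using that CPQ P'' Q' by metis
qed

section \<open>The possible co-factors\<close>

text \<open>For \<open>q0 = 1\<close> the coefficients of \<open>x\<^sup>2\<close> and \<open>x\<^sup>7\<close> give
  \<open>(q1 - q2) (c1 + q2 + 1) = c7 - c2\<close>, so \<open>q1 = q2\<close> is the main case.\<close>

lemma coefficient_classification:
  fixes a b c q0 q1 q2 c1 c2 c3 c4 c5 c6 c7 c8 c9 :: int
  assumes e0: "q0 = c1 - c9" and e1: "q1 + a * q0 = - c8 - 1" and e2: "q2 + a * q1 + b * q0 = - c7"
    and e3: "1 + a * q2 + b * q1 + c * q0 = - c6" and e4: "a + b * q2 + c * q1 + b * q0 = - c5"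
    and e5: "b + c * q2 + b * q1 + a * q0 = - c4" and e6: "c + b * q2 + a * q1 + q0 = - c3"
    and e7: "b + a * q2 + q1 = - c2" and e8: "a + q2 = - c1"
    and pos: "c1 \<ge> 1" "c2 \<ge> 0" "c3 \<ge> 0" "c4 \<ge> 0" "c6 \<ge> 0" "c7 \<ge> 0" "c8 \<ge> 0" "c9 \<ge> 0"
    and le: "c2 \<le> c1" "c3 \<le> c1" "c4 \<le> c1" "c6 \<le> c1" "c7 \<le> c1" "c8 \<le> c1" "c9 \<le> c1"
    and ne: "c9 \<noteq> c1"
    and Q1: "1 + q2 + q1 + q0 > 0"
    and lex4: "c4 = c1 \<Longrightarrow> c5 \<le> c2"
    and lex7: "c7 = c1 \<Longrightarrow> c8 \<le> c2" "c7 = c1 \<Longrightarrow> c8 = c2 \<Longrightarrow> c9 \<le> c3"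
    and lex8: "c8 = c1 \<Longrightarrow> c9 \<le> c2"
  shows "q0 = 1 \<and> q1 = q2 \<and> (q2 = 1 \<or> q2 = 2)"
proof -
  have q0: "1 \<le> q0" "q0 \<le> c1" using e0 ne pos le by linarith+
  have a: "a = - c1 - q2" using e8 by linarith
  have b: "b = - c2 - q1 - a * q2" using e7 by linarith
  have q1: "q1 = q0 * (c1 + q2) - 1 - c8" using e1 by (simp add: a algebra_simps)
  have "\<not> 2 \<le> q0"
  proof
    assume q0_2: "2 \<le> q0"
    define A where "A = c1 + q2"
    have q2: "q2 = A - c1" by (simp add: A_def)
    \<comment> \<open>Here \<open>A = - a\<close>. When \<open>a\<close>, \<open>b\<close> and
      \<open>q1\<close> are eliminated from \<open>e2\<close>, the terms quadratic in
      \<open>A\<close> cancel.\<close>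
    have key: "A * (q0 * c1 + q0\<^sup>2 - 2 - c8) = - c1 + c7 - q0 * c2 + q0 * (1 + c8)"
      using e2 unfolding b q1 a q2 by (simp add: algebra_simps power2_eq_square)
    \<comment> \<open>This is \<open>Q(1) > 0\<close>; with \<open>q0 \<le> c1\<close> it makes
      \<open>A\<close> positive.\<close>
    have "(1 + q0) * A + q0 > c1 + c8"
      using Q1 unfolding q1 q2 by (simp add: algebra_simps)
    then have "(1 + q0) * A > 0" using q0 pos by linarith
    then have A1: "A \<ge> 1" using q0 by (simp add: zero_less_mult_iff)
    have qc: "q0 * c1 \<ge> 2 * c1" "q0 * q0 \<ge> 2 * q0" "q0 * c8 \<le> q0 * c1" "q0 * c2 \<ge> 0" "q0 * c1 \<ge> q0 * q0"
      using q0_2 q0 pos le by (auto intro: mult_right_mono mult_left_mono)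
    have nonneg: "0 \<le> q0 * c1 + q0\<^sup>2 - 2 - c8"
      using qc q0_2 pos(1) le(6) unfolding power2_eq_square by linarith
    \<comment> \<open>Otherwise \<open>key\<close> gives
      \<open>2 * (q0 * c1 + q0 ^ 2 - 2 - c8) \<le> q0 + q0 * c8\<close>, which is too small for
      \<open>q0 \<ge> 2\<close> and \<open>c8 \<le> c1\<close>.\<close>
    have "A < 2"
    proof (rule ccontr)
      assume "\<not> A < 2"
      then have "2 * (q0 * c1 + q0\<^sup>2 - 2 - c8) \<le> A * (q0 * c1 + q0\<^sup>2 - 2 - c8)"
        using nonneg \<open>\<not> A < 2\<close> by (intro mult_right_mono) auto
      also have "\<dots> \<le> q0 * (1 + c8)" unfolding key using qc le by linarith
      also have "q0 * (1 + c8) = q0 + q0 * c8" by (simp add: algebra_simps)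
      \<comment> \<open>Naming the products \<open>X\<close>, \<open>Y\<close>, \<open>Z\<close>
        makes the remaining inequalities linear.\<close>
      finally have "2 * (X + Y - 2 - c8) \<le> q0 + Z"
        if "X = q0 * c1" "Y = q0 * q0" "Z = q0 * c8" for X Y Z
        using that by (simp add: power2_eq_square)
      moreover obtain X Y Z where "X = q0 * c1" "Y = q0 * q0" "Z = q0 * c8" by blast
      moreover from this qc have "2 * c1 \<le> X" "2 * q0 \<le> Y" "Z \<le> X" by simp_all
      ultimately show False using q0_2 le(6) by (smt (verit))
    qed
    with A1 have A: "A = 1" by linarith
    have c8: "c8 \<le> 2 * q0 - c1"
      using \<open>(1 + q0) * A + q0 > c1 + c8\<close> A by simp
    then have "(q0 + 1) * c8 \<le> (q0 + 1) * (2 * q0 - c1)"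
      using q0 by (intro mult_left_mono) auto
    \<comment> \<open>The bound on \<open>c8\<close> and \<open>c7 \<le> c1\<close> enter
      \<open>key\<close> at \<open>A = 1\<close>; together with \<open>q0 \<le> c1\<close> only
      \<open>q0 = 2\<close> survives.\<close>
    then have main: "2 * (q0 * c1) + c1 + q0 * c2 \<le> q0 * q0 + 3 * q0 + 2"
      using key le(5) unfolding A by (simp add: power2_eq_square algebra_simps)
    then have "q0 * q0 \<le> 2 * q0 + 2" using qc q0 by linarith
    then have "q0 < 3" using mult_right_mono[of 3 q0 q0] by linarith
    then have q0': "q0 = 2" using q0_2 by linarith
    then have "5 * c1 + 2 * c2 \<le> 12" "c1 \<ge> 2" using main q0 by simp_all
    then have "c1 = 2" "c2 \<le> 1" using pos(2) by presburger+
    moreover from this have "6 + 2 * c2 = c7 + 3 * c8" using key unfolding A q0' by simp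
    ultimately have "c8 = 2" "c1 = 2" "c2 \<le> 1" using le pos by presburger+
    \<comment> \<open>The last candidate, \<open>q0 = c1 = c8 = 2\<close>, fails because
      \<open>c6\<close> exceeds \<open>c1\<close>.\<close>
    then have "q1 = -1" "q2 = -1" "a = -1" using q1 a q2 A q0' by auto
    moreover from this have "b = - c2" using b by simp
    moreover from calculation have "c = - 3 - c2 - c3" using e6 q0' by simp
    ultimately have "c6 = 4 + c2 + 2 * c3" using e3 q0' by simp
    then show False using pos le \<open>c1 = 2\<close> by linarith
  qed
  then have q0: "q0 = 1" using q0 by linarith
  have c9: "c9 = c1 - 1" using e0 q0 by linarith
  have c8: "c8 = c1 + q2 - q1 - 1" using q1 q0 by simp
  have diff: "(q1 - q2) * (c1 + q2 + 1) = c7 - c2"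
    using e2 e7 unfolding a q0 by (simp add: algebra_simps)
  \<comment> \<open>The bound \<open>c8 \<le> c1\<close> amounts to
    \<open>q1 \<ge> q2 - 1\<close>.\<close>
  consider "q1 = q2 - 1" | "q1 = q2" | "q1 > q2" using c8 le by linarith
  then show ?thesis
  proof cases
    case 1
    then have "q2 \<ge> 0" using Q1 q0 by linarith
    \<comment> \<open>Two digits would differ by more than \<open>c1\<close>.\<close>
    moreover have "c1 + q2 + 1 = c2 - c7" using diff 1 by simp
    ultimately show ?thesis using le pos by linarith
  next
    case 2
    define k where "k = q2"
    have q: "q1 = k" "q2 = k" using 2 k_def by simp_all
    have "k \<ge> 0" using Q1 q q0 by linarith
    have b': "b = - c2 - k + k * c1 + k * k" using b unfolding a q by (simp add: algebra_simps)
    have c': "c = - c3 - 1 - b * k - a * k" using e6 unfolding q q0 by (simp add: algebra_simps)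
    \<comment> \<open>The equations \<open>e7\<close>, \<open>e6\<close>, \<open>e5\<close>
      successively fix \<open>b\<close>, \<open>c\<close> and \<open>c4\<close>; the bounds on
      \<open>c4\<close> then restrict \<open>k\<close>.\<close>
    have c4: "c4 = c1 * (1 - k - 2 * k\<^sup>2 + k ^ 3) - c2 * (k\<^sup>2 - k - 1) + k * c3 + (3 * k - 3 * k ^ 3 + k ^ 4)"
      using e5 unfolding q q0 c' b' a by (simp add: algebra_simps power_numeral_reduce)
    have "k \<noteq> 0"
    proof
      assume k: "k = 0"
      then have "c4 = c1 + c2" using c4 by simp
      \<comment> \<open>The digits would start with \<open>c1, 0, c3, c1, c1\<close>, so the shift
        beginning at \<open>c4\<close> would exceed the sequence.\<close>
      then have "c2 = 0" "c4 = c1" using le pos by linarith+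
      moreover have "c5 = c1" using e4 b' \<open>c2 = 0\<close> unfolding q q0 k a by simp
      ultimately show False using lex4 pos by simp
    qed
    moreover have "\<not> k \<ge> 3"
    proof
      assume "k \<ge> 3"
      \<comment> \<open>In terms of \<open>j\<close> all polynomial coefficients become nonnegative,
        which yields \<open>c4 \<ge> 2 * c1 + 9\<close>.\<close>
      then obtain j where j: "k = j + 3" "j \<ge> 0" by (metis add.commute diff_add_cancel diff_ge_0_iff_ge)
      have "c2 * (k\<^sup>2 - k - 1) \<le> c1 * (k\<^sup>2 - k - 1)"
        using le j by (intro mult_right_mono) (auto simp: power2_eq_square algebra_simps)
      moreover have "k * c3 \<ge> 0" using j pos by simp
      ultimately have "c4 \<ge> c1 * (1 - k - 2 * k\<^sup>2 + k ^ 3 - (k\<^sup>2 - k - 1)) + (3 * k - 3 * k ^ 3 + k ^ 4)"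
        unfolding c4 by (simp add: algebra_simps)
      moreover have "1 - k - 2 * k\<^sup>2 + k ^ 3 - (k\<^sup>2 - k - 1) = 2 + (j ^ 3 + 6 * j\<^sup>2 + 9 * j)"
        unfolding j by (simp add: power_numeral_reduce algebra_simps)
      moreover have "3 * k - 3 * k ^ 3 + k ^ 4 = 9 + (j ^ 4 + 9 * j ^ 3 + 27 * j\<^sup>2 + 30 * j)"
        unfolding j by (simp add: power_numeral_reduce algebra_simps)
      moreover have "c1 * (2 + (j ^ 3 + 6 * j\<^sup>2 + 9 * j)) \<ge> c1 * 2"
        using j pos by (intro mult_left_mono) auto
      moreover have "j ^ 4 + 9 * j ^ 3 + 27 * j\<^sup>2 + 30 * j \<ge> 0" using j by simp
      ultimately have "c4 \<ge> c1 * 2 + 9" by simp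
      then show False using le pos by linarith
    qed
    ultimately show ?thesis using \<open>k \<ge> 0\<close> q q0 by auto
  next
    case 3
    \<comment> \<open>Now \<open>Q(1) > 0\<close> and \<open>c8 \<ge> 0\<close> read
      \<open>2 * s - 1 \<le> j \<le> c1 - 1\<close>, while \<open>diff'\<close> keeps
      \<open>j * (c1 + 1 - s)\<close> at most \<open>c1\<close>. Only \<open>s = j = 1\<close> is
      left.\<close>
    define j s where "j = q1 - q2" and "s = - q2"
    have q: "q2 = - s" "q1 = j - s" by (simp_all add: j_def s_def)
    have j: "j \<ge> 1" "j \<ge> 2 * s - 1" "j \<le> c1 - 1" using 3 Q1 q q0 c8 pos by auto
    have diff': "j * (c1 + 1 - s) = c7 - c2" using diff q by (simp add: algebra_simps)
    have "s \<ge> 1"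
    proof (rule ccontr)
      assume "\<not> s \<ge> 1"
      then have "1 * (c1 + 1) \<le> j * (c1 + 1 - s)" using j pos by (intro mult_mono) auto
      also have "\<dots> = c7 - c2" by fact
      finally show False using le(5) pos(2) by simp
    qed
    have "\<not> s \<ge> 2"
    proof
      assume s: "s \<ge> 2"
      have u: "c1 - s \<ge> 0" using j s by linarith
      have "(2 * s - 1) * (c1 + 1 - s) \<le> j * (c1 + 1 - s)" using j u by (intro mult_right_mono) auto
      also have "\<dots> = c7 - c2" by fact
      finally have "(2 * s - 1) * (c1 + 1 - s) \<le> c1" using le pos by linarith
      moreover have "(2 * s - 1) * (c1 + 1 - s) = c1 + (s - 1) * (2 * (c1 - s) + 1)"
        by (simp add: algebra_simps)
      moreover have "(s - 1) * (2 * (c1 - s) + 1) > 0" using s u by simp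
      ultimately show False by linarith
    qed
    then have s: "s = 1" using \<open>s \<ge> 1\<close> by linarith
    have jc: "j * c1 = c7 - c2" using diff' s by simp
    have "j < 2" using mult_right_mono[of 2 j c1] jc le pos by linarith
    then have "j = 1" using j by linarith
    then have c72: "c7 = c1" "c2 = 0" using jc le pos by auto
    have q': "q1 = 0" "q2 = -1" using q s \<open>j = 1\<close> by simp_all
    then have a': "a = 1 - c1" and "b = a" using a b c72 by auto
    moreover from this have "c = - c1 - c3" using e6 q' q0 by simp
    ultimately have c4': "c4 = c1 - 2 - c3" using e5 q' q0 by simp
    have c8': "c8 = c1 - 2" using c8 q' by simp
    \<comment> \<open>As \<open>c7 = c1\<close>, the shift at \<open>c7\<close> requires
      \<open>c8 = c1 - 2 \<le> c2 = 0\<close>, while \<open>c4 \<ge> 0\<close> gives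
      \<open>c1 \<ge> 2\<close>. Then \<open>c8 = c2\<close>, but \<open>c9 = 1\<close> exceeds
      \<open>c3 = 0\<close>.\<close>
    then have "c1 = 2" using lex7(1) c72 c4' pos by linarith
    then show ?thesis using lex7(2) c72 c8' c9 c4' pos by simp
  qed
qed

lemma cofactor_cases:
  assumes "\<beta> \<in> salem_deg 6" "\<beta> \<in> salem_parry 1 8"
  shows "\<beta> \<in> with_cofactor [:1, 1, 1, 1:] \<or> \<beta> \<in> with_cofactor [:1, 2, 2, 1:]"
proof -
  obtain a b c q0 q1 q2 where
    C: "companion_poly \<beta> = [:1, a, b, c, b, a, 1:] * [:q0, q1, q2, 1:]"
    and Q: "\<beta> \<in> with_cofactor [:q0, q1, q2, 1:]" and pos: "1 + q2 + q1 + q0 > 0"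
    using salem_parry_1_8_factorization assms by metis
  have b1: "\<beta> > 1" and parry: "parry \<beta>"
    and pre: "preperiod_length \<beta> = 1" and per: "period_length \<beta> = 8"
    using assms by (auto simp: salem_deg_def salem_parry_def salem_def)
  then have "\<beta> > 0" by simp
  \<comment> \<open>From \<open>r_n \<le> 1 = r_0\<close>, equal digits preserve the order of the
    remainders; this is the lexicographic condition on a shift that starts with
    \<open>c1\<close>.\<close>
  have lex: "beta_digit \<beta> (n + 2) \<le> beta_digit \<beta> 2"
    "beta_digit \<beta> (n + 2) = beta_digit \<beta> 2 \<Longrightarrow> beta_digit \<beta> (n + 3) \<le> beta_digit \<beta> 3"
    if "beta_digit \<beta> (n + 1) = beta_digit \<beta> 1" for n
  proof -
    have r1: "beta_rem \<beta> (Suc n) \<le> beta_rem \<beta> (Suc 0)"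
      using beta_rem_bounds(2) that by (intro beta_rem_mono[OF \<open>\<beta> > 0\<close>]) auto
    from beta_digit_mono[OF \<open>\<beta> > 0\<close> this]
    show "beta_digit \<beta> (n + 2) \<le> beta_digit \<beta> 2" by (simp add: numeral_2_eq_2)
    assume "beta_digit \<beta> (n + 2) = beta_digit \<beta> 2"
    then have "beta_rem \<beta> (Suc (Suc n)) \<le> beta_rem \<beta> (Suc (Suc 0))"
      using beta_rem_mono[OF \<open>\<beta> > 0\<close> r1] by (simp add: numeral_2_eq_2 del: beta_rem.simps)
    from beta_digit_mono[OF \<open>\<beta> > 0\<close> this]
    show "beta_digit \<beta> (n + 3) \<le> beta_digit \<beta> 3" by (simp add: numeral_3_eq_3)
  qed
  note bnd = beta_digit_bounds[OF \<open>\<beta> > 0\<close>]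
  let ?d = "beta_digit \<beta>"
  have eqs: "q0 = ?d 1 - ?d 9 \<and> q1 + a * q0 = - ?d 8 - 1 \<and> q2 + a * q1 + b * q0 = - ?d 7
    \<and> 1 + a * q2 + b * q1 + c * q0 = - ?d 6 \<and> a + b * q2 + c * q1 + b * q0 = - ?d 5
    \<and> b + c * q2 + b * q1 + a * q0 = - ?d 4 \<and> c + b * q2 + a * q1 + q0 = - ?d 3
    \<and> b + a * q2 + q1 = - ?d 2 \<and> a + q2 = - ?d 1"
    using C[unfolded companion_poly_1_8[OF pre per]] by (simp add: algebra_simps)
  have lexs: "?d 4 = ?d 1 \<Longrightarrow> ?d 5 \<le> ?d 2" "?d 7 = ?d 1 \<Longrightarrow> ?d 8 \<le> ?d 2"
    "?d 7 = ?d 1 \<Longrightarrow> ?d 8 = ?d 2 \<Longrightarrow> ?d 9 \<le> ?d 3" "?d 8 = ?d 1 \<Longrightarrow> ?d 9 \<le> ?d 2"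
    using lex(1)[of 3] lex[of 6] lex(1)[of 7] by simp_all
  have "q0 = 1 \<and> q1 = q2 \<and> (q2 = 1 \<or> q2 = 2)"
    by (intro coefficient_classification[of q0 "?d 1" "?d 9" q1 a "?d 8" q2 b "?d 7" c "?d 6"
        "?d 5" "?d 4" "?d 3" "?d 2"])
      (fact beta_digit_1_pos[OF b1] periodic_1_8D(2)[OF b1 parry pre per] pos bnd lexs
        | use eqs in blast)+
  then show ?thesis using Q by auto
qed

section \<open>Two Salem numbers of degree 6\<close>

text \<open>Modulo 2 the polynomial becomes \<open>x\<^sup>6 + x\<^sup>3 + 1\<close>, the ninth cyclotomic polynomial, which is
  irreducible since 2 is a primitive root modulo 9.\<close>

lemma sextic_no_factor_mod_2:
  fixes a b c f0 f1 f2 g0 g1 g2 g3 g4 :: int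
  assumes "even a" "even b" "odd c"
  shows "[:f0, 1:] * [:g0, g1, g2, g3, g4, 1:] \<noteq> [:1, a, b, c, b, a, 1:]"
    "[:f0, f1, 1:] * [:g0, g1, g2, g3, 1:] \<noteq> [:1, a, b, c, b, a, 1:]"
    "[:f0, f1, f2, 1:] * [:g0, g1, g2, 1:] \<noteq> [:1, a, b, c, b, a, 1:]"
proof -
  show "[:f0, 1:] * [:g0, g1, g2, g3, g4, 1:] \<noteq> [:1, a, b, c, b, a, 1:]"
  proof
    assume "[:f0, 1:] * [:g0, g1, g2, g3, g4, 1:] = [:1, a, b, c, b, a, 1:]"
    then have "f0 * g0 = 1" "f0 * g1 + g0 = a" "f0 * g2 + g1 = b" "f0 * g3 + g2 = c"
      "f0 * g4 + g3 = b" "f0 + g4 = a"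
      by (simp_all add: algebra_simps)
    \<comment> \<open>Reading only parities leaves a propositional problem in the parities of the
      unknown coefficients.\<close>
    then have "odd (f0 * g0)" "even (f0 * g1 + g0)" "even (f0 * g2 + g1)" "odd (f0 * g3 + g2)"
      "even (f0 * g4 + g3)" "even (f0 + g4)"
      using assms by (metis odd_one)+
    then show False unfolding even_add even_mult_iff by satx
  qed
  show "[:f0, f1, 1:] * [:g0, g1, g2, g3, 1:] \<noteq> [:1, a, b, c, b, a, 1:]"
  proof
    assume "[:f0, f1, 1:] * [:g0, g1, g2, g3, 1:] = [:1, a, b, c, b, a, 1:]"
    then have "f0 * g0 = 1" "f0 * g1 + f1 * g0 = a" "f0 * g2 + f1 * g1 + g0 = b"
      "f0 * g3 + f1 * g2 + g1 = c" "f0 + f1 * g3 + g2 = b" "f1 + g3 = a"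
      by (simp_all add: algebra_simps)
    then have "odd (f0 * g0)" "even (f0 * g1 + f1 * g0)" "even (f0 * g2 + f1 * g1 + g0)"
      "odd (f0 * g3 + f1 * g2 + g1)" "even (f0 + f1 * g3 + g2)" "even (f1 + g3)"
      using assms by (metis odd_one)+
    then show False unfolding even_add even_mult_iff by satx
  qed
  show "[:f0, f1, f2, 1:] * [:g0, g1, g2, 1:] \<noteq> [:1, a, b, c, b, a, 1:]"
  proof
    assume "[:f0, f1, f2, 1:] * [:g0, g1, g2, 1:] = [:1, a, b, c, b, a, 1:]"
    then have "f0 * g0 = 1" "f0 * g1 + f1 * g0 = a" "f0 * g2 + f1 * g1 + f2 * g0 = b"
      "f0 + f1 * g2 + f2 * g1 + g0 = c" "f1 + f2 * g2 + g1 = b" "f2 + g2 = a"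
      by (simp_all add: algebra_simps)
    then have "odd (f0 * g0)" "even (f0 * g1 + f1 * g0)" "even (f0 * g2 + f1 * g1 + f2 * g0)"
      "odd (f0 + f1 * g2 + f2 * g1 + g0)" "even (f1 + f2 * g2 + g1)" "even (f2 + g2)"
      using assms by (metis odd_one)+
    then show False unfolding even_add even_mult_iff by satx
  qed
qed

text \<open>Naming the coefficients of both factors reduces each degree to one of the shapes
  excluded modulo 2. Applied to either factor, this covers every proper factorization.\<close>

lemma sextic_factor_degree:
  fixes f g :: "int poly"
  assumes "f * g = [:1, a, b, c, b, a, 1:]" "even a" "even b" "odd c"
    "lead_coeff f = 1" "lead_coeff g = 1"
  shows "degree f \<notin> {1, 2, 3}"
proof
  assume d: "degree f \<in> {1, 2, 3}"
  have "f \<noteq> 0" "g \<noteq> 0" using assms by auto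
  then have dfg: "degree f + degree g = 6"
    using degree_mult_eq[of f g] assms(1) by simp
  obtain fs where fs: "length fs = degree f" "f = Poly (fs @ [1])"
    using monic_poly_coeffs[OF assms(5)] by blast
  obtain gs where gs: "length gs = degree g" "g = Poly (gs @ [1])"
    using monic_poly_coeffs[OF assms(6)] by blast
  consider "length fs = 1" "length gs = 5" | "length fs = 2" "length gs = 4" | "length fs = 3" "length gs = 3"
    using d dfg fs(1) gs(1) by auto
  then show False
  proof cases
    case 1
    then obtain f0 g0 g1 g2 g3 g4 where "fs = [f0]" "gs = [g0, g1, g2, g3, g4]"
      by (auto simp: length_Suc_conv numeral_eq_Suc)
    then show False
      using assms(1) sextic_no_factor_mod_2(1)[OF assms(2-4), of f0 g0 g1 g2 g3 g4] fs(2) gs(2) by simp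
  next
    case 2
    then obtain f0 f1 g0 g1 g2 g3 where "fs = [f0, f1]" "gs = [g0, g1, g2, g3]"
      by (auto simp: length_Suc_conv numeral_eq_Suc)
    then show False
      using assms(1) sextic_no_factor_mod_2(2)[OF assms(2-4), of f0 f1 g0 g1 g2 g3] fs(2) gs(2) by simp
  next
    case 3
    then obtain f0 f1 f2 g0 g1 g2 where "fs = [f0, f1, f2]" "gs = [g0, g1, g2]"
      by (auto simp: length_Suc_conv numeral_eq_Suc)
    then show False
      using assms(1) sextic_no_factor_mod_2(3)[OF assms(2-4), of f0 f1 f2 g0 g1 g2] fs(2) gs(2) by simp
  qed
qed

lemma min_poly_sextic:
  fixes a b c :: int
  assumes "even a" "even b" "odd c" "poly [:1, of_int a, of_int b, of_int c, of_int b, of_int a, 1:] \<beta> = 0"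
  shows "algebraic_int \<beta>" "min_poly \<beta> = rat_poly_of [:1, a, b, c, b, a, 1:]"
proof -
  define P where "P = [:1, a, b, c, b, a, 1:]"
  have lead: "lead_coeff P = 1" and deg: "degree P = 6" by (simp_all add: P_def)
  have root: "poly (map_poly of_int P) \<beta> = 0"
    using assms(4) by (simp add: P_def map_poly_pCons)
  with lead show alg: "algebraic_int \<beta>" by (rule algebraic_int_rootI)
  note m = min_poly_algebraic_int[OF alg]
  obtain f g where fg: "P = f * g" and f: "min_poly \<beta> = rat_poly_of f"
    and lf: "lead_coeff f = 1" and lg: "lead_coeff g = 1"
    using min_poly_integral_cofactor[OF lead root] by blast
  have "f \<noteq> 0" "g \<noteq> 0" using lf lg by auto
  then have sum: "degree f + degree g = 6"
    using degree_mult_eq[of f g] fg deg by simp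
  have "degree f \<notin> {1, 2, 3}" "degree g \<notin> {1, 2, 3}"
    using sextic_factor_degree[of f g] sextic_factor_degree[of g f] fg[symmetric] lf lg assms(1-3)
    by (auto simp: P_def mult.commute)
  moreover have "degree f \<noteq> 0"
  proof
    assume "degree f = 0"
    then obtain u where "f = [:u:]" by (rule degree_eq_zeroE)
    then have "f = 1" using lf by simp
    then show False using m(2) f by simp
  qed
  ultimately have "degree g = 0" using sum by auto
  then obtain u where "g = [:u:]" by (rule degree_eq_zeroE)
  then have "g = 1" using lg by simp
  then show "min_poly \<beta> = rat_poly_of [:1, a, b, c, b, a, 1:]"
    using f fg P_def by simp
qed

text \<open>The discriminant \<open>y ^ 2 - 4\<close> is negative, so \<open>z\<close> is not real
  and \<open>y = 2 * Re z\<close>; the real part of the equation then becomes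
  \<open>u ^ 2 + v ^ 2 = 1\<close>.\<close>

lemma norm_1_if_real_trace:
  fixes z :: complex and y :: real
  assumes "z\<^sup>2 - of_real y * z + 1 = 0" "\<bar>y\<bar> < 2"
  shows "norm z = 1"
proof -
  define u v where "u = Re z" and "v = Im z"
  have z: "z = Complex u v" by (simp add: u_def v_def)
  have re: "u\<^sup>2 - v\<^sup>2 - y * u + 1 = 0" and im: "v * (2 * u - y) = 0"
    using assms(1) unfolding z by (auto simp: complex_eq_iff power2_eq_square algebra_simps)
  have "v \<noteq> 0"
  proof
    assume "v = 0"
    then have "(u - y / 2)\<^sup>2 + (1 - (y / 2)\<^sup>2) = 0"
      using re by (simp add: power2_eq_square field_simps)
    moreover have "(y / 2)\<^sup>2 < 1" using assms(2) by (simp add: abs_square_less_1)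
    ultimately show False using zero_le_power2[of "u - y / 2"] by linarith
  qed
  then have "y = 2 * u" using im by simp
  then have "u\<^sup>2 + v\<^sup>2 = 1" using re by (simp add: power2_eq_square)
  then show ?thesis by (simp add: z cmod_def)
qed

text \<open>With \<open>y = x + 1/x\<close> the reciprocal sextic becomes \<open>x\<^sup>3 U(y)\<close>, where \<open>U\<close> is the trace cubic.\<close>

lemma sextic_trace_cubic:
  fixes x a b c :: "'a::field"
  assumes "x \<noteq> 0"
  shows "poly [:1, a, b, c, b, a, 1:] x = x ^ 3 * poly [:c - 2 * a, b - 3, a, 1:] (x + 1 / x)"
  using assms by (simp add: field_simps power_numeral_reduce)

lemma cubic_three_roots:
  fixes p q r x y z w :: "'a::field"
  assumes "poly [:r, q, p, 1:] x = 0" "poly [:r, q, p, 1:] y = 0" "poly [:r, q, p, 1:] z = 0"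
    "poly [:r, q, p, 1:] w = 0" "x \<noteq> y" "x \<noteq> z" "y \<noteq> z"
  shows "w = x \<or> w = y \<or> w = z"
proof (rule ccontr)
  assume "\<not> ?thesis"
  then have "card {x, y, z, w} = 4" using assms by auto
  moreover have "card {x, y, z, w} \<le> card {v. poly [:r, q, p, 1:] v = 0}"
    using assms by (intro card_mono poly_roots_finite) auto
  moreover have "card {v. poly [:r, q, p, 1:] v = 0} \<le> degree [:r, q, p, 1:]"
    by (rule card_poly_roots_bound) simp
  ultimately show False by simp
qed

text \<open>The signs of \<open>U\<close> give two roots in \<open>(-2, 2)\<close>, and
  \<open>\<beta> + 1 / \<beta>\<close> is the third, above 2. For a conjugate \<open>z\<close>, the
  number \<open>z + 1 / z\<close> is one of these: the first two put \<open>z\<close> on the unit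
  circle, the third leaves \<open>z = 1 / \<beta>\<close>.\<close>

lemma salem_sextic:
  fixes a b c :: int and U :: "real poly"
  assumes "even a" "even b" "odd c"
  defines "U \<equiv> [:of_int (c - 2 * a), of_int (b - 3), of_int a, 1:]"
  assumes "poly U (-2) < 0" "poly U 0 > 0" "poly U 2 < 0"
    and "\<beta> > 1" "poly [:1, of_int a, of_int b, of_int c, of_int b, of_int a, 1:] \<beta> = 0"
  shows "salem \<beta>"
proof -
  note m = min_poly_sextic[OF assms(1-3,9)]
  obtain y1 where y1: "-2 < y1" "y1 < 0" "poly U y1 = 0"
    using poly_IVT_pos[of "-2" 0 U] assms by auto
  obtain y2 where y2: "0 < y2" "y2 < 2" "poly U y2 = 0"
    using poly_IVT_neg[of 0 2 U] assms by auto
  define y3 where "y3 = \<beta> + 1 / \<beta>"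
  have "(\<beta> - 1)\<^sup>2 > 0" using assms(8) by simp
  then have "y3 > 2"
    using assms(8) by (simp add: y3_def field_simps power2_eq_square)
  have "poly U y3 = 0"
    using sextic_trace_cubic[of \<beta> "of_int a" "of_int b" "of_int c"] assms(8,9) by (simp add: U_def y3_def)
  define V :: "complex poly" where "V = [:of_int c - 2 * of_int a, of_int b - 3, of_int a, 1:]"
  have V: "poly V (of_real y) = 0" if "poly U y = 0" for y
  proof -
    have "poly V (of_real y) = of_real (poly U y)" by (simp add: V_def U_def)
    then show ?thesis using that by simp
  qed
  have conj: "z \<in> other_conjugates \<beta> \<longleftrightarrow> z \<noteq> of_real \<beta> \<and> z \<noteq> 0 \<and> poly V (z + 1 / z) = 0" for z
  proof (cases "z = 0")
    case True
    then show ?thesis by (simp add: other_conjugates_def m(2) eval_rat_of_int map_poly_pCons)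
  next
    case False
    then show ?thesis
      using sextic_trace_cubic[of z "of_int a" "of_int b" "of_int c"]
      by (auto simp: other_conjugates_def m(2) eval_rat_of_int map_poly_pCons V_def)
  qed
  have quad: "z + 1 / z = w \<longleftrightarrow> z\<^sup>2 - w * z + 1 = 0" if "z \<noteq> 0" for z w :: complex
    using that by (auto simp: field_simps power2_eq_square)
  have "norm z \<le> 1" if z: "z \<in> other_conjugates \<beta>" for z
  proof -
    have zc: "z \<noteq> of_real \<beta>" "z \<noteq> 0" "poly V (z + 1 / z) = 0" using z conj by auto
    have "z + 1 / z = of_real y1 \<or> z + 1 / z = of_real y2 \<or> z + 1 / z = of_real y3"
      using zc(3) V[OF y1(3)] V[OF y2(3)] V[OF \<open>poly U y3 = 0\<close>] y1 y2 \<open>y3 > 2\<close>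
      unfolding V_def by (intro cubic_three_roots) auto
    then consider y where "z + 1 / z = of_real y" "\<bar>y\<bar> < 2" | "z + 1 / z = of_real y3"
      using y1 y2 by fastforce
    then show ?thesis
    proof cases
      case (1 y)
      then show ?thesis using norm_1_if_real_trace[of z y] quad zc by simp
    next
      case 2
      then have "z\<^sup>2 - of_real y3 * z + 1 = 0" using quad zc by simp
      moreover have "z\<^sup>2 - of_real y3 * z + 1 = (z - of_real \<beta>) * (z - of_real (1 / \<beta>))"
        using assms(8) by (simp add: y3_def field_simps power2_eq_square)
      ultimately have "z = of_real (1 / \<beta>)" using zc by simp
      then show ?thesis using assms(8) by (simp add: norm_divide)
    qed
  qed
  moreover have "\<exists>z\<in>other_conjugates \<beta>. norm z = 1"
  proof -
    \<comment> \<open>This is the root of \<open>z ^ 2 - y1 * z + 1\<close> in the upper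
      half-plane.\<close>
    define z where "z = Complex (y1 / 2) (sqrt (1 - (y1 / 2)\<^sup>2))"
    have lt: "(y1 / 2)\<^sup>2 < 1" using y1 by (simp add: abs_square_less_1)
    then have im: "Im z > 0" by (simp add: z_def)
    then have "z \<noteq> 0" "z \<noteq> of_real \<beta>" by auto
    have eq: "z\<^sup>2 - of_real y1 * z + 1 = 0"
      using lt by (simp add: z_def complex_eq_iff power2_eq_square field_simps)
    then have "z + 1 / z = of_real y1" using quad \<open>z \<noteq> 0\<close> by simp
    then have "z \<in> other_conjugates \<beta>"
      using conj V y1(3) \<open>z \<noteq> 0\<close> \<open>z \<noteq> of_real \<beta>\<close> by simp
    moreover have "norm z = 1" using norm_1_if_real_trace[OF eq] y1 by simp
    ultimately show ?thesis by blast
  qed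
  ultimately show ?thesis
    using m(1) assms(8) by (simp add: salem_def)
qed

text \<open>One step of interval arithmetic: the products of the bounds enclose
  \<open>\<beta> r_n\<close>, and an enclosure inside \<open>[d, d + 1)\<close> fixes the digit. The
  premise \<open>k = Suc n\<close> allows numerals as indices.\<close>

lemma greedy_step:
  assumes "lo \<le> \<beta> \<and> \<beta> \<le> hi" "l \<le> beta_rem \<beta> n \<and> beta_rem \<beta> n \<le> u" "k = Suc n"
    and "0 \<le> lo" "0 \<le> l" "l' + of_int d \<le> lo * l" "hi * u \<le> u' + of_int d" "0 \<le> l'" "u' < 1"
  shows "beta_digit \<beta> k = d \<and> l' \<le> beta_rem \<beta> k \<and> beta_rem \<beta> k \<le> u'"
proof -
  have "lo * l \<le> \<beta> * beta_rem \<beta> n" "\<beta> * beta_rem \<beta> n \<le> hi * u"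
    using assms by (auto intro!: mult_mono)
  then have b: "l' + of_int d \<le> \<beta> * beta_rem \<beta> n" "\<beta> * beta_rem \<beta> n \<le> u' + of_int d"
    using assms by linarith+
  then have d: "beta_digit \<beta> k = d"
    using assms by (simp add: beta_digit_def floor_eq_iff)
  then show ?thesis
    using b assms(3) by (simp add: beta_rem_Suc del: beta_rem.simps)
qed

text \<open>The sign conditions make \<open>\<beta>\<close> Salem. The polynomial identity,
  evaluated at \<open>\<beta>\<close>, gives \<open>r_9 = r_1\<close>, because digit polynomials
  take the remainders as values there.\<close>

lemma sextic_attains_cofactor:
  fixes a b c :: int and U :: "real poly"
  assumes "even a" "even b" "odd c"
  defines "U \<equiv> [:of_int (c - 2 * a), of_int (b - 3), of_int a, 1:]"
  assumes "poly U (-2) < 0" "poly U 0 > 0" "poly U 2 < 0"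
    and "\<beta> > 1" "poly [:1, of_int a, of_int b, of_int c, of_int b, of_int a, 1:] \<beta> = 0"
    and dig: "digit_poly \<beta> 9 - digit_poly \<beta> 1 = [:1, a, b, c, b, a, 1:] * Q"
    and "beta_digit \<beta> 9 \<noteq> beta_digit \<beta> 1" "beta_rem \<beta> 1 \<noteq> 0"
    and "\<And>n. n \<in> {2..8} \<Longrightarrow> beta_rem \<beta> n \<noteq> beta_rem \<beta> 1"
  shows "\<beta> \<in> salem_deg 6 \<inter> salem_parry 1 8" "\<beta> \<in> with_cofactor Q"
proof -
  have salem: "salem \<beta>"
    using assms(1-9) unfolding U_def by (intro salem_sextic[of a b c \<beta>]) auto
  note m = min_poly_sextic[OF assms(1-3,9)]
  have "poly (map_poly of_int (digit_poly \<beta> 9 - digit_poly \<beta> 1)) \<beta> = 0"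
    using assms(9) unfolding dig map_poly_of_int_mult poly_mult
    by (simp only: map_poly_pCons of_int_0 of_int_1 map_poly_0 mult_zero_left)
  moreover have "map_poly of_int (p - q) = map_poly of_int p - (map_poly of_int q :: real poly)" for p q
    by (rule poly_eqI) (simp add: coeff_map_poly)
  ultimately have r: "beta_rem \<beta> 9 = beta_rem \<beta> 1"
    by (simp add: poly_digit_poly del: beta_rem.simps)
  have ne: "beta_rem \<beta> (1 + p) \<noteq> beta_rem \<beta> 1" if "1 \<le> p" "p < 8" for p
    using that by (intro assms(13)) auto
  note per = periodic_1_8I[OF assms(8) r assms(11) ne assms(12)]
  show "\<beta> \<in> salem_deg 6 \<inter> salem_parry 1 8"
    using salem per by (simp add: salem_deg_def salem_parry_def m(2))
  have "companion_poly \<beta> = [:1, a, b, c, b, a, 1:] * Q"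
    using dig per(2,3) by (simp add: companion_poly_def)
  then have "rat_poly_of (companion_poly \<beta>) = min_poly \<beta> * rat_poly_of Q"
    by (simp only: m(2) map_poly_of_int_mult)
  then show "\<beta> \<in> with_cofactor Q"
    using salem per by (simp add: with_cofactor_def)
qed

text \<open>The trace cubic is \<open>y ^ 3 - 2 y ^ 2 - 3 y + 5\<close>, with values
  \<open>-5\<close>, \<open>5\<close>, \<open>-1\<close> at \<open>-2\<close>, \<open>0\<close>,
  \<open>2\<close>.\<close>

lemma cofactor_1111_attained:
  "\<exists>\<beta> \<in> salem_deg 6 \<inter> salem_parry 1 8. \<beta> \<in> with_cofactor [:1, 1, 1, 1:]"
proof -
  \<comment> \<open>Each step magnifies the enclosure roughly by the factor \<open>\<beta>\<close>;
    a starting width of \<open>0.0001\<close> still separates the first nine digits.\<close>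
  obtain \<beta> :: real where b: "1.831 < \<beta>" "\<beta> < 1.8311" and root: "poly [:1, -2, 0, 1, 0, -2, 1:] \<beta> = 0"
    using poly_IVT_pos[of "1.831" "1.8311" "[:1, -2, 0, 1, 0, -2, 1:]"] by auto
  have lohi: "1.831 \<le> \<beta> \<and> \<beta> \<le> 1.8311" using b by simp
  have r0: "1 \<le> beta_rem \<beta> 0 \<and> beta_rem \<beta> 0 \<le> 1" by simp
  have r1: "beta_digit \<beta> 1 = 1 \<and> 0.8310 \<le> beta_rem \<beta> 1 \<and> beta_rem \<beta> 1 \<le> 0.8311"
    by (rule greedy_step[OF lohi r0]) simp_all
  have r2: "beta_digit \<beta> 2 = 1 \<and> 0.5215 \<le> beta_rem \<beta> 2 \<and> beta_rem \<beta> 2 \<le> 0.5219"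
    by (rule greedy_step[OF lohi r1[THEN conjunct2]]) simp_all
  have r3: "beta_digit \<beta> 3 = 0 \<and> 0.9548 \<le> beta_rem \<beta> 3 \<and> beta_rem \<beta> 3 \<le> 0.9557"
    by (rule greedy_step[OF lohi r2[THEN conjunct2]]) simp_all
  have r4: "beta_digit \<beta> 4 = 1 \<and> 0.7482 \<le> beta_rem \<beta> 4 \<and> beta_rem \<beta> 4 \<le> 0.7500"
    by (rule greedy_step[OF lohi r3[THEN conjunct2]]) simp_all
  have r5: "beta_digit \<beta> 5 = 1 \<and> 0.3699 \<le> beta_rem \<beta> 5 \<and> beta_rem \<beta> 5 \<le> 0.3734"
    by (rule greedy_step[OF lohi r4[THEN conjunct2]]) simp_all
  have r6: "beta_digit \<beta> 6 = 0 \<and> 0.6772 \<le> beta_rem \<beta> 6 \<and> beta_rem \<beta> 6 \<le> 0.6838"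
    by (rule greedy_step[OF lohi r5[THEN conjunct2]]) simp_all
  have r7: "beta_digit \<beta> 7 = 1 \<and> 0.2399 \<le> beta_rem \<beta> 7 \<and> beta_rem \<beta> 7 \<le> 0.2522"
    by (rule greedy_step[OF lohi r6[THEN conjunct2]]) simp_all
  have r8: "beta_digit \<beta> 8 = 0 \<and> 0.4392 \<le> beta_rem \<beta> 8 \<and> beta_rem \<beta> 8 \<le> 0.4619"
    by (rule greedy_step[OF lohi r7[THEN conjunct2]]) simp_all
  have r9: "beta_digit \<beta> 9 = 0 \<and> 0.8041 \<le> beta_rem \<beta> 9 \<and> beta_rem \<beta> 9 \<le> 0.8458"
    by (rule greedy_step[OF lohi r8[THEN conjunct2]]) simp_all
  note digits = r1[THEN conjunct1] r2[THEN conjunct1] r3[THEN conjunct1] r4[THEN conjunct1] r5[THEN conjunct1] r6[THEN conjunct1] r7[THEN conjunct1] r8[THEN conjunct1] r9[THEN conjunct1] digit_poly_9 digit_poly_1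
  \<comment> \<open>The enclosure of \<open>r_1\<close> is disjoint from those of \<open>r_2\<close>
    to \<open>r_8\<close>; that of \<open>r_9\<close> contains it.\<close>
  have ne: "beta_rem \<beta> n \<noteq> beta_rem \<beta> 1" if "n \<in> {2..8}" for n
  proof -
    have "n = 2 \<or> n = 3 \<or> n = 4 \<or> n = 5 \<or> n = 6 \<or> n = 7 \<or> n = 8" using that by auto
    then show ?thesis using r1 r2 r3 r4 r5 r6 r7 r8 by (elim disjE) (simp_all del: beta_rem.simps)
  qed
  show ?thesis
  proof (intro bexI)
    show "\<beta> \<in> with_cofactor [:1, 1, 1, 1:]" "\<beta> \<in> salem_deg 6 \<inter> salem_parry 1 8"
      by (rule sextic_attains_cofactor[of "-2" 0 1 \<beta> "[:1, 1, 1, 1:]"]; use b root r1 r9 digits ne in \<open>simp del: beta_rem.simps\<close>)+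
  qed
qed

text \<open>The trace cubic is \<open>y ^ 3 - 4 y ^ 2 + 3 y + 1\<close>, with values
  \<open>-29\<close>, \<open>1\<close>, \<open>-1\<close> at \<open>-2\<close>, \<open>0\<close>,
  \<open>2\<close>.\<close>

lemma cofactor_1221_attained:
  "\<exists>\<beta> \<in> salem_deg 6 \<inter> salem_parry 1 8. \<beta> \<in> with_cofactor [:1, 2, 2, 1:]"
proof -
  obtain \<beta> :: real where b: "2.3821 < \<beta>" "\<beta> < 2.3822" and root: "poly [:1, -4, 6, -7, 6, -4, 1:] \<beta> = 0"
    using poly_IVT_pos[of "2.3821" "2.3822" "[:1, -4, 6, -7, 6, -4, 1:]"] by auto
  have lohi: "2.3821 \<le> \<beta> \<and> \<beta> \<le> 2.3822" using b by simp
  have r0: "1 \<le> beta_rem \<beta> 0 \<and> beta_rem \<beta> 0 \<le> 1" by simp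
  have r1: "beta_digit \<beta> 1 = 2 \<and> 0.3821 \<le> beta_rem \<beta> 1 \<and> beta_rem \<beta> 1 \<le> 0.3822"
    by (rule greedy_step[OF lohi r0]) simp_all
  have r2: "beta_digit \<beta> 2 = 0 \<and> 0.9102 \<le> beta_rem \<beta> 2 \<and> beta_rem \<beta> 2 \<le> 0.9105"
    by (rule greedy_step[OF lohi r1[THEN conjunct2]]) simp_all
  have r3: "beta_digit \<beta> 3 = 2 \<and> 0.1681 \<le> beta_rem \<beta> 3 \<and> beta_rem \<beta> 3 \<le> 0.1690"
    by (rule greedy_step[OF lohi r2[THEN conjunct2]]) simp_all
  have r4: "beta_digit \<beta> 4 = 0 \<and> 0.4004 \<le> beta_rem \<beta> 4 \<and> beta_rem \<beta> 4 \<le> 0.4026"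
    by (rule greedy_step[OF lohi r3[THEN conjunct2]]) simp_all
  have r5: "beta_digit \<beta> 5 = 0 \<and> 0.9537 \<le> beta_rem \<beta> 5 \<and> beta_rem \<beta> 5 \<le> 0.9591"
    by (rule greedy_step[OF lohi r4[THEN conjunct2]]) simp_all
  have r6: "beta_digit \<beta> 6 = 2 \<and> 0.2718 \<le> beta_rem \<beta> 6 \<and> beta_rem \<beta> 6 \<le> 0.2848"
    by (rule greedy_step[OF lohi r5[THEN conjunct2]]) simp_all
  have r7: "beta_digit \<beta> 7 = 0 \<and> 0.6474 \<le> beta_rem \<beta> 7 \<and> beta_rem \<beta> 7 \<le> 0.6785"
    by (rule greedy_step[OF lohi r6[THEN conjunct2]]) simp_all
  have r8: "beta_digit \<beta> 8 = 1 \<and> 0.5421 \<le> beta_rem \<beta> 8 \<and> beta_rem \<beta> 8 \<le> 0.6164"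
    by (rule greedy_step[OF lohi r7[THEN conjunct2]]) simp_all
  have r9: "beta_digit \<beta> 9 = 1 \<and> 0.2913 \<le> beta_rem \<beta> 9 \<and> beta_rem \<beta> 9 \<le> 0.4684"
    by (rule greedy_step[OF lohi r8[THEN conjunct2]]) simp_all
  note digits = r1[THEN conjunct1] r2[THEN conjunct1] r3[THEN conjunct1] r4[THEN conjunct1] r5[THEN conjunct1] r6[THEN conjunct1] r7[THEN conjunct1] r8[THEN conjunct1] r9[THEN conjunct1] digit_poly_9 digit_poly_1
  \<comment> \<open>The closest to \<open>r_1\<close>, near \<open>0.382\<close>, is
    \<open>r_4\<close>, above \<open>0.4\<close>.\<close>
  have ne: "beta_rem \<beta> n \<noteq> beta_rem \<beta> 1" if "n \<in> {2..8}" for n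
  proof -
    have "n = 2 \<or> n = 3 \<or> n = 4 \<or> n = 5 \<or> n = 6 \<or> n = 7 \<or> n = 8" using that by auto
    then show ?thesis using r1 r2 r3 r4 r5 r6 r7 r8 by (elim disjE) (simp_all del: beta_rem.simps)
  qed
  show ?thesis
  proof (intro bexI)
    show "\<beta> \<in> with_cofactor [:1, 2, 2, 1:]" "\<beta> \<in> salem_deg 6 \<inter> salem_parry 1 8"
      by (rule sextic_attains_cofactor[of "-4" 6 "-7" \<beta> "[:1, 2, 2, 1:]"]; use b root r1 r9 digits ne in \<open>simp del: beta_rem.simps\<close>)+
  qed
qed

theorem proposition3p5:
  shows "minimal_cofactor_set 6 1 8 = {[:1, 1, 1, 1:], [:1, 2, 2, 1:]}"
proof -
  let ?L = "{[:1, 1, 1, 1:], [:1, 2, 2, 1:]} :: int poly set"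
  \<comment> \<open>A cubic co-factor of the companion polynomial of degree 9 leaves degree 6 for
    the minimal polynomial.\<close>
  have "\<beta> \<in> salem_deg 6" if "\<beta> \<in> salem_parry 1 8" "\<beta> \<in> with_cofactor q" "q \<in> ?L" for \<beta> q
  proof -
    have per: "preperiod_length \<beta> = 1" "period_length \<beta> = 8" and salem: "salem \<beta>"
      using that by (auto simp: salem_parry_def)
    have "degree (companion_poly \<beta>) = 9" by (simp add: companion_poly_1_8[OF per])
    moreover have eq: "rat_poly_of (companion_poly \<beta>) = min_poly \<beta> * rat_poly_of q"
      using that(2) by (simp add: with_cofactor_def)
    moreover have "min_poly \<beta> \<noteq> 0"
      using salem min_poly_algebraic_int(2)[of \<beta>] by (auto simp: salem_def)
    moreover have "q \<noteq> 0" "degree q = 3" using that(3) by auto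
    ultimately have "9 = degree (min_poly \<beta>) + 3"
      by (metis degree_mult_eq degree_rat_poly_of map_poly_of_int_inject map_poly_0)
    then show ?thesis using salem by (simp add: salem_deg_def)
  qed
  then have "is_cofactor_set 6 1 8 ?L"
    unfolding is_cofactor_set_def cofactors_of_def
    using cofactor_1111_attained cofactor_1221_attained cofactor_cases by blast
  then show ?thesis
    using minimal_cofactor_set_eq is_cofactor_set_unique by metis
qed

end
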